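(* Let $\alpha$ be a composition of $n>0$. The map $\mathbf{Flip}\circ\Theta$ is an anti-isomorphism (order-reversing bijection with order-reversing inverse) between the $\alpha$-Tamari lattice $\mathcal{T}_\alpha$ and the $\mathbf{Flip}(\nu_\alpha)$-Tamari lattice $\mathcal{T}_{\mathbf{Flip}(\nu_\alpha)}$.
   Context: Let $n>0$, $\alpha=(\alpha_1,\dots,\alpha_r)$ a composition of $n$. Put $s_0=0$, $s_a=\alpha_1+\cdots+\alpha_a$. The $a$-th $\alpha$-region is $\{s_{a-1}+1,\dots,s_a\}$, and $\varrho(i)$ is the index of the region containing $i$. $\mathfrak{S}_\alpha=\{w\in\mathfrak{S}_n\mid w(i)<w(i+1)\text{ whenever }\varrho(i)=\varrho(i+1)\}$; write $w_i=w(i)$. $\mathfrak{S}_\alpha(231)$ is the set of $w\in\mathfrak{S}_\alpha$ for which there are no indices $i<j<k$, each in a different $\alpha$-region, with $w_i<w_j$ and $w_i=w_k+1$. With $\mathrm{Inv}(w)=\{(i,j)\mid i<j,\ w_i>w_j\}$, the weak order is $u\leq_L v\iff\mathrm{Inv}(u)\subseteq\mathrm{Inv}(v)$, and $\mathcal{T}_\alpha=(\mathfrak{S}_\alpha(231),\leq_L)$ (known to be a lattice). Northeast paths are lattice paths (starting on the $x$-axis, say at the origin) with steps $N=(0,1)$ and $E=(1,0)$. $\nu_\alpha=N^{\alpha_1}E^{\alpha_1}\cdots N^{\alpha_r}E^{\alpha_r}$. $\mathbf{Flip}(\nu)$ is obtained by reversing the step word of $\nu$ and exchanging $N$ and $E$.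 For a northeast path $\nu$, $\mathcal{L}_\nu$ is the set of northeast paths with the same starting and ending points as $\nu$ that never go below $\nu$. For a lattice point $Q$ on $\mu\in\mathcal{L}_\nu$, $\mathrm{horiz}_\nu(Q)$ is the largest number of east steps that can be added to $Q$ without crossing to the other side of $\nu$ (i.e. the $x$-coordinate of the rightmost point of $\nu$ at the height of $Q$, minus the $x$-coordinate of $Q$). A valley of $\mu$ is a lattice point $V$ on $\mu$ preceded by an east step and followed by a north step. The rotation of $\mu$ by a valley $V$ is the path $\mu'\in\mathcal{L}_\nu$ obtained by exchanging the east step before $V$ with the portion of $\mu$ between $V$ and the next lattice point $W$ on $\mu$ after $V$ with $\mathrm{horiz}_\nu(W)=\mathrm{horiz}_\nu(V)$; then $\mu$ is placed below $\mu'$. The reflexive and transitive closure is a partial order on $\mathcal{L}_\nu$; the resulting poset is the $\nu$-Tamari lattice $\mathcal{T}_\nu$. The map $\Theta$: for $w\in\mathfrak{S}_\alpha(231)$ build a labeled plane tree $T(w)$. Start with a root labeled $n+1$, and read $w(1),w(2),\dots,w(n)$ in order. Upon reading $w(i)$, start a walk at the root; on reaching a node $v$ with label $\ell$, if $w(i)<\ell$ move to the left-most child of $v$, otherwise move to the first sibling of $v$ on its right. When the destination node does not exist, add it (at that place) with label $w(i)$ and end the walk. Then define the northeast path $\Theta(w)$: start with $N^{k}$ where $k$ is the number of children of the root; then for $a=1,\dots,r$ and, within region $a$, for $i$ running from $s_a$ down to $s_{a-1}+1$, append $EN^{k_i}$, where $k_i$ is the number of children of the node of $T(w)$ labeled $w(i)$.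 It is known that $\Theta(w)\in\mathcal{L}_{\nu_\alpha}$, so $\mathbf{Flip}(\Theta(w))\in\mathcal{L}_{\mathbf{Flip}(\nu_\alpha)}$. *)

theory Defs
  imports "HOL-Combinatorics.Permutations"
begin

definition is_composition :: "nat list \<Rightarrow> nat \<Rightarrow> bool" where
  "is_composition \<alpha> n \<longleftrightarrow> (\<forall>a \<in> set \<alpha>. 0 < a) \<and> sum_list \<alpha> = n"

definition psum :: "nat list \<Rightarrow> nat \<Rightarrow> nat" where
  "psum \<alpha> a = sum_list (take a \<alpha>)"

definition region :: "nat list \<Rightarrow> nat \<Rightarrow> nat set" where
  "region \<alpha> a = {psum \<alpha> (a - 1) + 1..psum \<alpha> a}"

text \<open>Regions are numbered from 1; the index is only meaningful for positions in
  \<open>{1..sum_list \<alpha>}\<close>.\<close>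

definition region_index :: "nat list \<Rightarrow> nat \<Rightarrow> nat" where
  "region_index \<alpha> i = (THE a. a \<in> {1..length \<alpha>} \<and> i \<in> region \<alpha> a)"

definition alpha_perms :: "nat list \<Rightarrow> (nat \<Rightarrow> nat) set" where
  "alpha_perms \<alpha> = {w. w permutes {1..sum_list \<alpha>} \<and>
     (\<forall>i. i \<in> {1..sum_list \<alpha>} \<and> i + 1 \<in> {1..sum_list \<alpha>} \<and>
          region_index \<alpha> i = region_index \<alpha> (i + 1) \<longrightarrow> w i < w (i + 1))}"

definition has_alpha_231 :: "nat list \<Rightarrow> (nat \<Rightarrow> nat) \<Rightarrow> bool" where
  "has_alpha_231 \<alpha> w \<longleftrightarrow>
     (\<exists>i j k. 1 \<le> i \<and> i < j \<and> j < k \<and> k \<le> sum_list \<alpha> \<and>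
        region_index \<alpha> i \<noteq> region_index \<alpha> j \<and>
        region_index \<alpha> j \<noteq> region_index \<alpha> k \<and>
        region_index \<alpha> i \<noteq> region_index \<alpha> k \<and>
        w i < w j \<and> w i = w k + 1)"

definition alpha_perms_231 :: "nat list \<Rightarrow> (nat \<Rightarrow> nat) set" where
  "alpha_perms_231 \<alpha> = {w \<in> alpha_perms \<alpha>. \<not> has_alpha_231 \<alpha> w}"

definition Inv :: "nat \<Rightarrow> (nat \<Rightarrow> nat) \<Rightarrow> (nat \<times> nat) set" where
  "Inv n w = {(i, j). 1 \<le> i \<and> i < j \<and> j \<le> n \<and> w i > w j}"

definition weak_le :: "nat \<Rightarrow> (nat \<Rightarrow> nat) \<Rightarrow> (nat \<Rightarrow> nat) \<Rightarrow> bool" where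
  "weak_le n u v \<longleftrightarrow> Inv n u \<subseteq> Inv n v"

text \<open>A northeast path is its step word; all paths start at the origin.\<close>

datatype step = N | E

type_synonym path = "step list"

definition endpoint :: "path \<Rightarrow> nat \<times> nat" where
  "endpoint \<mu> = (count_list \<mu> E, count_list \<mu> N)"

definition lattice_points :: "path \<Rightarrow> (nat \<times> nat) set" where
  "lattice_points \<mu> = {endpoint (take k \<mu>) | k. k \<le> length \<mu>}"

definition nu_of :: "nat list \<Rightarrow> path" where
  "nu_of \<alpha> = concat (map (\<lambda>a. replicate a N @ replicate a E) \<alpha>)"

fun swap_step :: "step \<Rightarrow> step" where
  "swap_step N = E"
| "swap_step E = N"

definition Flip :: "path \<Rightarrow> path" where
  "Flip \<mu> = map swap_step (rev \<mu>)"

definition strictly_below :: "nat \<times> nat \<Rightarrow> path \<Rightarrow> bool" where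
  "strictly_below Q \<nu> \<longleftrightarrow> (\<forall>y. (fst Q, y) \<in> lattice_points \<nu> \<longrightarrow> snd Q < y)"

text \<open>For paths with common endpoints it suffices to compare lattice points: if an east
  step of \<open>\<mu>\<close> runs below \<open>\<nu>\<close>, then so does its right end.\<close>

definition paths_above :: "path \<Rightarrow> path set" where
  "paths_above \<nu> = {\<mu>. endpoint \<mu> = endpoint \<nu> \<and>
     (\<forall>Q \<in> lattice_points \<mu>. \<not> strictly_below Q \<nu>)}"

definition horiz :: "path \<Rightarrow> nat \<times> nat \<Rightarrow> int" where
  "horiz \<nu> Q = int (Max {x. (x, snd Q) \<in> lattice_points \<nu>}) - int (fst Q)"

text \<open>The valley is \<open>V = endpoint (A @ [E])\<close>, the east step before it is moved past the
  portion \<open>B\<close> of the path from \<open>V\<close> to \<open>W = endpoint (A @ [E] @ B)\<close>; the last condition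
  says that \<open>W\<close> is the first lattice point after \<open>V\<close> with the same value of \<open>horiz\<close>.\<close>

definition rotation :: "path \<Rightarrow> path \<Rightarrow> path \<Rightarrow> bool" where
  "rotation \<nu> \<mu> \<mu>' \<longleftrightarrow> \<mu> \<in> paths_above \<nu> \<and> \<mu>' \<in> paths_above \<nu> \<and>
     (\<exists>A B C. \<mu> = A @ [E] @ B @ C \<and> \<mu>' = A @ B @ [E] @ C \<and>
        B \<noteq> [] \<and> hd B = N \<and>
        horiz \<nu> (endpoint (A @ [E] @ B)) = horiz \<nu> (endpoint (A @ [E])) \<and>
        (\<forall>k. 0 < k \<and> k < length B \<longrightarrow>
           horiz \<nu> (endpoint (A @ [E] @ take k B)) \<noteq> horiz \<nu> (endpoint (A @ [E]))))"

definition nu_tamari_le :: "path \<Rightarrow> path \<Rightarrow> path \<Rightarrow> bool" where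
  "nu_tamari_le \<nu> = (rotation \<nu>)\<^sup>*\<^sup>*"

datatype ltree = Node (label: nat) (children: "ltree list")

text \<open>Arguments: the letter read and a list of siblings, the walk being at the leftmost of
  them; an empty list means that the destination of the walk does not exist.\<close>

fun insert_walk :: "nat \<Rightarrow> ltree list \<Rightarrow> ltree list" where
  "insert_walk x [] = [Node x []]"
| "insert_walk x (Node l cs # ts) =
     (if x < l then Node l (insert_walk x cs) # ts else Node l cs # insert_walk x ts)"

text \<open>The walk starts at the root, viewed as a one-element list of siblings. As all letters
  read are smaller than the label of the root, this list remains a singleton.\<close>

definition tree_of :: "nat \<Rightarrow> (nat \<Rightarrow> nat) \<Rightarrow> ltree" where
  "tree_of n w = hd (fold insert_walk (map w [1..<n + 1]) [Node (n + 1) []])"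

fun nodes :: "ltree \<Rightarrow> ltree list" where
  "nodes (Node l cs) = Node l cs # concat (map nodes cs)"

text \<open>In \<open>tree_of n w\<close> every label in \<open>{1..n + 1}\<close> occurs exactly once.\<close>

definition num_children :: "ltree \<Rightarrow> nat \<Rightarrow> nat" where
  "num_children T l = length (children (the (find (\<lambda>v. label v = l) (nodes T))))"

definition Theta :: "nat list \<Rightarrow> (nat \<Rightarrow> nat) \<Rightarrow> path" where
  "Theta \<alpha> w =
     (let T = tree_of (sum_list \<alpha>) w in
      replicate (length (children T)) N @
      concat (map (\<lambda>a.
        concat (map (\<lambda>i. E # replicate (num_children T (w i)) N)
          (rev [psum \<alpha> (a - 1) + 1..<psum \<alpha> a + 1])))
        [1..<length \<alpha> + 1]))"

definition anti_isomorphism ::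
  "'a set \<Rightarrow> ('a \<Rightarrow> 'a \<Rightarrow> bool) \<Rightarrow> 'b set \<Rightarrow> ('b \<Rightarrow> 'b \<Rightarrow> bool) \<Rightarrow> ('a \<Rightarrow> 'b) \<Rightarrow> bool" where
  "anti_isomorphism A leA B leB f \<longleftrightarrow>
     bij_betw f A B \<and>
     monotone_on A leA (\<lambda>x y. leB y x) f \<and>
     monotone_on B leB (\<lambda>x y. leA y x) (inv_into A f)"

end

theory Submission
  imports Defs
begin

text \<open>Both orders become componentwise orders on the same set of vectors.

  On the side of the paths these are the bracket vectors of \<open>\<nu>\<close>-Tamari lattices (Ceballos,
  Padrol and Sarmiento), which record for each east step of \<open>\<nu>\<close> the row in which it is matched
  by the path; a rotation raises exactly one entry, by the least possible amount.

  On the side of the permutations the parent of a position \<open>k\<close> in the tree \<open>T(w)\<close> is the position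
  of the least letter exceeding \<open>w k\<close> among those before \<open>k\<close>. If \<open>w\<close> avoids 231, it is also the
  lowest among all the positions inverted with \<open>k\<close> when positions are ordered by the row of the
  path which they produce. So larger inversion sets have lower parents, and conversely the
  inversions of \<open>w\<close> can be read off the chains of ancestors. The rows of the parents form the
  bracket vector of \<open>Flip (Theta \<alpha> w)\<close>.\<close>

section \<open>Paths by their rows\<close>

text \<open>The dictionary between the two sides: item \<open>i\<close> of the stack is position
  \<open>n - i\<close>, because the flipped path meets the regions from right to left. The item of
  \<open>k\<close> has been pushed by the row of \<open>p\<close> exactly when \<open>p\<close> lies
  in an earlier region than \<open>k\<close>. In this way the stack discipline becomes a condition
  on parents alone, \<open>parent_map\<close>. The obstacle is surjectivity: such a map prescribes
  at most one inversion per position, and a whole permutation has to be found. The other inversions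
  are forced, and they form the inversion set of a permutation because they and their complement are
  both transitive. A forbidden pattern needs consecutive values, while parents are defined through
  arbitrary larger letters. The proofs bridge this by moving through the values one unit at a time,
  until two consecutive ones sit on opposite sides of the middle position.\<close>

fun reach :: "path \<Rightarrow> nat \<Rightarrow> nat" where
  "reach [] y = 0"
| "reach (E # \<mu>) y = Suc (reach \<mu> y)"
| "reach (N # \<mu>) 0 = 0"
| "reach (N # \<mu>) (Suc y) = reach \<mu> y"

lemma reach_Suc: "reach \<mu> y \<le> reach \<mu> (Suc y)"
  by (induction \<mu> y rule: reach.induct) auto

lemma reach_mono: "y \<le> z \<Longrightarrow> reach \<mu> y \<le> reach \<mu> z"
  using lift_Suc_mono_le[of "reach \<mu>"] reach_Suc by blast

lemma reach_total: "count_list \<mu> N \<le> y \<Longrightarrow> reach \<mu> y = count_list \<mu> E"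
  by (induction \<mu> y rule: reach.induct) auto

lemma reach_le: "reach \<mu> y \<le> count_list \<mu> E"
  by (metis nle_le reach_mono reach_total)

lemma reach_append:
  "reach (\<mu> @ \<mu>') y =
     (if y < count_list \<mu> N then reach \<mu> y else count_list \<mu> E + reach \<mu>' (y - count_list \<mu> N))"
  by (induction \<mu> y rule: reach.induct) auto

lemma path_eqI:
  assumes "count_list \<mu> N = count_list \<mu>' N" "\<And>y. reach \<mu> y = reach \<mu>' y"
  shows "\<mu> = \<mu>'"
  using assms
proof (induction \<mu> arbitrary: \<mu>')
  case Nil
  then show ?case
  proof (cases \<mu>')
    case (Cons s \<tau>)
    then show ?thesis using Nil(1) Nil(2)[of 0] by (cases s) auto
  qed simp
next
  case (Cons s \<mu>)
  note hyp = Cons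
  show ?case
  proof (cases \<mu>')
    case Nil
    then show ?thesis using hyp(2) hyp(3)[of 0] by (cases s) auto
  next
    case (Cons s' \<tau>)
    have eq: "s = s'" using hyp(3)[of 0] Cons by (cases s; cases s') auto
    have "\<mu> = \<tau>"
    proof (rule hyp(1))
      show "count_list \<mu> N = count_list \<tau> N" using hyp(2) Cons eq by (auto split: if_splits)
      show "reach \<mu> y = reach \<tau> y" for y
        using hyp(3)[of y] hyp(3)[of "Suc y"] Cons eq by (cases s) auto
    qed
    then show ?thesis using Cons eq by simp
  qed
qed

lemma lattice_points_Cons:
  "lattice_points (s # \<mu>) = insert (0, 0)
     ((\<lambda>(x, y). if s = E then (Suc x, y) else (x, Suc y)) ` lattice_points \<mu>)"
proof -
  have "{k. k \<le> length (s # \<mu>)} = insert 0 (Suc ` {k. k \<le> length \<mu>})"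
    using atMost_Suc_eq_insert_0[of "length \<mu>"] by (simp add: atMost_def)
  then have "lattice_points (s # \<mu>) =
      (\<lambda>k. endpoint (take k (s # \<mu>))) ` insert 0 (Suc ` {k. k \<le> length \<mu>})"
    unfolding lattice_points_def by blast
  also have "\<dots> = insert (0, 0) ((\<lambda>k. endpoint (s # take k \<mu>)) ` {k. k \<le> length \<mu>})"
    by (simp add: image_image endpoint_def)
  also have "\<dots> = insert (0, 0)
     ((\<lambda>(x, y). if s = E then (Suc x, y) else (x, Suc y)) ` lattice_points \<mu>)"
    unfolding lattice_points_def by (cases s) (auto simp: endpoint_def image_iff)
  finally show ?thesis .
qed

text \<open>\<open>reach \<mu> y\<close> is the abscissa of the right end of row \<open>y\<close>,
  constant from the top row on. A row begins where the previous one ends; quantifying over all lower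
  rows covers row \<open>0\<close>, which begins at \<open>0\<close>, as well.\<close>

lemma lattice_points_iff:
  "(x, y) \<in> lattice_points \<mu> \<longleftrightarrow>
     y \<le> count_list \<mu> N \<and> x \<le> reach \<mu> y \<and> (\<forall>z<y. reach \<mu> z \<le> x)"
proof (induction \<mu> arbitrary: x y)
  case Nil
  then show ?case by (auto simp: lattice_points_def endpoint_def)
next
  case (Cons s \<mu>)
  show ?case
  proof (cases s)
    case E
    then have "(x, y) \<in> lattice_points (s # \<mu>) \<longleftrightarrow>
        (x = 0 \<and> y = 0) \<or> (\<exists>x'. x = Suc x' \<and> (x', y) \<in> lattice_points \<mu>)"
      by (auto simp: lattice_points_Cons)
    then show ?thesis using E by (cases x) (auto simp: Cons.IH)
  next
    case N
    then have "(x, y) \<in> lattice_points (s # \<mu>) \<longleftrightarrow>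
        (x = 0 \<and> y = 0) \<or> (\<exists>y'. y = Suc y' \<and> (x, y') \<in> lattice_points \<mu>)"
      by (auto simp: lattice_points_Cons)
    then show ?thesis using N by (cases y) (auto simp: Cons.IH All_less_Suc2)
  qed
qed

text \<open>The lowest point of \<open>\<nu>\<close> with abscissa \<open>x\<close> is in the first
  row whose right end is not left of \<open>x\<close>. By monotonicity this row is at most
  \<open>y\<close> exactly when row \<open>y\<close> itself reaches \<open>x\<close>.\<close>

lemma not_strictly_below_iff:
  assumes "y \<le> count_list \<nu> N"
  shows "\<not> strictly_below (x, y) \<nu> \<longleftrightarrow> x \<le> reach \<nu> y"
proof
  assume "\<not> strictly_below (x, y) \<nu>"
  then obtain y' where "(x, y') \<in> lattice_points \<nu>" "y' \<le> y"
    by (auto simp: strictly_below_def not_less)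
  then show "x \<le> reach \<nu> y" using reach_mono[of y' y \<nu>] by (auto simp: lattice_points_iff)
next
  assume x: "x \<le> reach \<nu> y"
  define y' where "y' = (LEAST z. x \<le> reach \<nu> z)"
  have "x \<le> reach \<nu> y'" "y' \<le> y" unfolding y'_def using x by (auto intro: LeastI Least_le)
  moreover have "reach \<nu> z \<le> x" if "z < y'" for z
    using not_less_Least[of z "\<lambda>z. x \<le> reach \<nu> z"] that unfolding y'_def by simp
  ultimately have "(x, y') \<in> lattice_points \<nu>" using assms by (auto simp: lattice_points_iff)
  then show "\<not> strictly_below (x, y) \<nu>" using \<open>y' \<le> y\<close> by (force simp: strictly_below_def)
qed

lemma paths_above_iff:
  "\<mu> \<in> paths_above \<nu> \<longleftrightarrow> endpoint \<mu> = endpoint \<nu> \<and> (\<forall>y. reach \<mu> y \<le> reach \<nu> y)"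
proof (cases "endpoint \<mu> = endpoint \<nu>")
  case True
  then have NE: "count_list \<mu> N = count_list \<nu> N" "count_list \<mu> E = count_list \<nu> E"
    by (auto simp: endpoint_def)
  have "(\<forall>Q \<in> lattice_points \<mu>. \<not> strictly_below Q \<nu>) \<longleftrightarrow> (\<forall>y. reach \<mu> y \<le> reach \<nu> y)"
  proof
    assume *: "\<forall>Q \<in> lattice_points \<mu>. \<not> strictly_below Q \<nu>"
    show "\<forall>y. reach \<mu> y \<le> reach \<nu> y"
    proof
      fix y
      show "reach \<mu> y \<le> reach \<nu> y"
      proof (cases "y \<le> count_list \<nu> N")
        case True
        then have "(reach \<mu> y, y) \<in> lattice_points \<mu>"
          using NE by (simp add: lattice_points_iff reach_mono)
        then show ?thesis using * not_strictly_below_iff[OF True] by blast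
      qed (use NE in \<open>simp add: reach_total\<close>)
    qed
  next
    assume *: "\<forall>y. reach \<mu> y \<le> reach \<nu> y"
    show "\<forall>Q \<in> lattice_points \<mu>. \<not> strictly_below Q \<nu>"
    proof
      fix Q assume "Q \<in> lattice_points \<mu>"
      moreover obtain x y where Q: "Q = (x, y)" by force
      ultimately have "y \<le> count_list \<nu> N" "x \<le> reach \<mu> y" using NE by (auto simp: lattice_points_iff)
      then show "\<not> strictly_below Q \<nu>" unfolding Q using *[rule_format, of y]
        by (simp add: not_strictly_below_iff)
    qed
  qed
  then show ?thesis using True by (simp add: paths_above_def)
qed (simp add: paths_above_def)

lemma horiz_eq:
  assumes "y \<le> count_list \<nu> N"
  shows "horiz \<nu> (x, y) = int (reach \<nu> y) - int x"
proof -
  have "{x. (x, y) \<in> lattice_points \<nu>} = {x. x \<le> reach \<nu> y \<and> (\<forall>z<y. reach \<nu> z \<le> x)}"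
    using assms by (simp add: lattice_points_iff)
  moreover have "finite {x. x \<le> reach \<nu> y \<and> (\<forall>z<y. reach \<nu> z \<le> x)}" by simp
  ultimately have "Max {x. (x, y) \<in> lattice_points \<nu>} = reach \<nu> y"
    using reach_mono by (intro Max_eqI) auto
  then show ?thesis by (simp add: horiz_def)
qed

section \<open>Bracket vectors\<close>

text \<open>Read a path row by row with a stack: before row \<open>y\<close> the items \<open>i < reach \<nu> y\<close> have been
  pushed in increasing order, and every east step in row \<open>y\<close> pops one item. The bracket
  vector sends each item to the row in which it is popped; the height of the stack is \<open>horiz\<close>.\<close>

definition bracket_vector :: "path \<Rightarrow> (nat \<Rightarrow> nat) \<Rightarrow> bool" where
  "bracket_vector \<nu> b \<longleftrightarrow>
     (\<forall>i < count_list \<nu> E. b i \<le> count_list \<nu> N \<and> i < reach \<nu> (b i)) \<and>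
     (\<forall>i j. i < j \<and> j < reach \<nu> (b i) \<longrightarrow> b j \<le> b i)"

definition bracket_of :: "path \<Rightarrow> path \<Rightarrow> (nat \<Rightarrow> nat) \<Rightarrow> bool" where
  "bracket_of \<nu> \<mu> b \<longleftrightarrow> bracket_vector \<nu> b \<and> endpoint \<mu> = endpoint \<nu> \<and>
     (\<forall>y. reach \<mu> y = card {i. i < count_list \<nu> E \<and> b i \<le> y})"

section \<open>Existence and uniqueness of the bracket vector of a path\<close>

lemma upper_sets_eq:
  fixes S T X :: "nat set"
  assumes "finite X" "S \<subseteq> X" "T \<subseteq> X" "card S = card T"
    and S: "\<And>i j. i \<in> S \<Longrightarrow> j \<in> X \<Longrightarrow> i < j \<Longrightarrow> j \<in> S"
    and T: "\<And>i j. i \<in> T \<Longrightarrow> j \<in> X \<Longrightarrow> i < j \<Longrightarrow> j \<in> T"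
  shows "S = T"
proof -
  have "S \<subseteq> T \<or> T \<subseteq> S"
    by (metis S T assms(2,3) linorder_neqE_nat subsetD subsetI)
  then show ?thesis
    using assms by (metis card_subset_eq finite_subset)
qed

lemma ex_upper_set:
  fixes X :: "nat set"
  assumes "finite X" "g \<le> card X"
  shows "\<exists>S \<subseteq> X. card S = g \<and> (\<forall>i j. i \<in> S \<longrightarrow> j \<in> X \<longrightarrow> i < j \<longrightarrow> j \<in> S)"
  using assms(2)
proof (induction g)
  case (Suc g)
  then obtain S where S: "S \<subseteq> X" "card S = g" "\<forall>i j. i \<in> S \<longrightarrow> j \<in> X \<longrightarrow> i < j \<longrightarrow> j \<in> S"
    by auto
  have fin: "finite S" using S assms(1) finite_subset by blast
  have "X - S \<noteq> {}" using S(2) Suc.prems card_mono[OF fin, of X] by auto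
  then have m: "Max (X - S) \<in> X - S" using assms(1) by (intro Max_in) simp_all
  have "\<forall>i j. i \<in> insert (Max (X - S)) S \<longrightarrow> j \<in> X \<longrightarrow> i < j \<longrightarrow> j \<in> insert (Max (X - S)) S"
    using S(3) assms(1) Max_ge[of "X - S"] by (metis Diff_iff finite_Diff insert_iff not_less)
  moreover have "card (insert (Max (X - S)) S) = Suc g" using m fin S by simp
  moreover have "insert (Max (X - S)) S \<subseteq> X" using m S(1) by simp
  ultimately show ?case by metis
qed (intro exI[of _ "{}"], simp)

text \<open>Run the stack: \<open>S\<close> is the set of items popped before row \<open>y\<close>.
  Row \<open>y\<close> has \<open>reach \<mu> y - card S\<close> east steps, and at least that many
  items are on the stack because \<open>\<mu>\<close> stays above \<open>\<nu>\<close>. Popping the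
  topmost ones preserves the last-in-first-out condition.\<close>

lemma ex_bracket_of:
  assumes "\<mu> \<in> paths_above \<nu>"
  shows "\<exists>b. bracket_of \<nu> \<mu> b"
proof -
  let ?m = "count_list \<nu> E" and ?n = "count_list \<nu> N"
  have end_eq: "count_list \<mu> E = ?m" "count_list \<mu> N = ?n" "endpoint \<mu> = endpoint \<nu>"
    and le: "\<And>y. reach \<mu> y \<le> reach \<nu> y"
    using assms by (auto simp: paths_above_iff endpoint_def)
  define good where "good b y S \<longleftrightarrow>
      (\<forall>i\<in>S. b i < y \<and> i < reach \<nu> (b i) \<and> (\<forall>j. i < j \<and> j < reach \<nu> (b i) \<longrightarrow> j \<in> S \<and> b j \<le> b i)) \<and>
      (\<forall>z<y. reach \<mu> z = card {i \<in> S. b i \<le> z})" for b :: "nat \<Rightarrow> nat" and y S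
  have ex: "\<exists>b S. good b y S" for y
  proof (induction y)
    case 0
    show ?case by (intro exI[of _ "\<lambda>_. 0"] exI[of _ "{}"]) (simp add: good_def)
  next
    case (Suc y)
    then obtain b S where good: "good b y S" by blast
    have "S \<subseteq> {..<reach \<nu> y}"
    proof
      fix i assume "i \<in> S"
      then have "i < reach \<nu> (b i)" "b i \<le> y" using good by (auto simp: good_def)
      then show "i \<in> {..<reach \<nu> y}" using reach_mono[of "b i" y \<nu>] by simp
    qed
    then have fin: "finite S" using finite_subset by blast
    have cS: "card S \<le> reach \<mu> y"
    proof (cases y)
      case 0
      then have "S = {}" using good by (auto simp: good_def)
      then show ?thesis by simp
    next
      case (Suc z)
      have "{i \<in> S. b i \<le> z} = S" using good Suc by (auto simp: good_def)
      then have "card S = reach \<mu> z" using good Suc by (auto simp: good_def)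
      then show ?thesis using Suc reach_Suc by simp
    qed
    \<comment> \<open>The items on the stack in row \<open>y\<close>. Larger items were pushed
      later, so an upper set of \<open>?X\<close> is a top segment of the stack.\<close>
    let ?X = "{..<reach \<nu> y} - S"
    have X: "finite ?X" "reach \<mu> y - card S \<le> card ?X"
      using \<open>S \<subseteq> _\<close> fin le[of y] by (simp_all add: card_Diff_subset diff_le_mono)
    then obtain T where T: "T \<subseteq> ?X" "card T = reach \<mu> y - card S"
      "\<forall>i j. i \<in> T \<longrightarrow> j \<in> ?X \<longrightarrow> i < j \<longrightarrow> j \<in> T"
      using ex_upper_set[OF X] by metis
    define b' where "b' i = (if i \<in> T then y else b i)" for i
    have bS: "b' i = b i" if "i \<in> S" for i using that T by (auto simp: b'_def)
    have bT: "b' i = y" if "i \<in> T" for i using that by (auto simp: b'_def)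
    have ltS: "b i < y" if "i \<in> S" for i using that good by (auto simp: good_def)
    have finT: "finite T" using T finite_subset by blast
    have "good b' (Suc y) (S \<union> T)"
      unfolding good_def
    proof (intro conjI ballI allI impI)
      fix i assume i: "i \<in> S \<union> T"
      then show "b' i < Suc y" using bS bT ltS by force
      show "i < reach \<nu> (b' i)" using i good bS bT T by (auto simp: good_def)
      fix j assume j: "i < j \<and> j < reach \<nu> (b' i)"
      have "j \<in> S \<union> T \<and> b' j \<le> b' i"
      proof (cases "i \<in> S")
        case True
        then have "j \<in> S" "b j \<le> b i" using good j bS[OF True] by (auto simp: good_def)
        then show ?thesis using bS True by auto
      next
        case False
        then have "i \<in> T" using i by blast
        then have "j \<in> S \<union> T" using j bT T(3) by auto
        then show ?thesis using bS bT ltS \<open>i \<in> T\<close> by (metis UnE le_refl less_imp_le)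
      qed
      then show "j \<in> S \<union> T" "b' j \<le> b' i" by auto
    next
      fix z assume z: "z < Suc y"
      show "reach \<mu> z = card {i \<in> S \<union> T. b' i \<le> z}"
      proof (cases "z = y")
        case True
        have "{i \<in> S \<union> T. b' i \<le> z} = S \<union> T" using True bS bT ltS by force
        moreover have "card (S \<union> T) = card S + card T" using T fin finT by (intro card_Un_disjoint) auto
        ultimately show ?thesis using True T(2) cS by simp
      next
        case False
        then have "{i \<in> S \<union> T. b' i \<le> z} = {i \<in> S. b i \<le> z}" using z bS bT by auto
        then show ?thesis using good False z by (auto simp: good_def)
      qed
    qed
    then show ?case by blast
  qed
  obtain b S where good: "good b (Suc ?n) S" using ex by blast
  have S: "S = {i. i < ?m}"
  proof -
    have sub: "S \<subseteq> {i. i < ?m}"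
    proof
      fix i assume "i \<in> S"
      then show "i \<in> {i. i < ?m}" using good reach_le[of \<nu> "b i"] by (auto simp: good_def)
    qed
    have "{i \<in> S. b i \<le> ?n} = S" using good by (auto simp: good_def)
    then have "card S = ?m" using good end_eq reach_total[of \<mu> ?n] by (auto simp: good_def)
    then show ?thesis using sub by (intro card_subset_eq) auto
  qed
  define b' where "b' i = (if i < ?m then b i else 0)" for i
  have "bracket_vector \<nu> b'"
    unfolding bracket_vector_def
  proof (intro conjI allI impI)
    fix i assume "i < ?m"
    then show "b' i \<le> ?n" "i < reach \<nu> (b' i)" using good S by (auto simp: good_def b'_def)
  next
    fix i j assume ij: "i < j \<and> j < reach \<nu> (b' i)"
    then have "j < ?m" using reach_le[of \<nu> "b' i"] by simp
    then show "b' j \<le> b' i" using good S ij by (auto simp: good_def b'_def)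
  qed
  moreover have "reach \<mu> y = card {i. i < ?m \<and> b' i \<le> y}" for y
  proof (cases "y \<le> ?n")
    case True
    have "{i. i < ?m \<and> b' i \<le> y} = {i \<in> S. b i \<le> y}" using S by (auto simp: b'_def)
    then show ?thesis using good True by (simp add: good_def)
  next
    case False
    then have "{i. i < ?m \<and> b' i \<le> y} = {..<?m}" using S good by (auto simp: good_def b'_def)
    then show ?thesis using False end_eq by (simp add: reach_total)
  qed
  ultimately show ?thesis using end_eq by (auto simp: bracket_of_def)
qed

text \<open>The path dictates how many items each row pops, and these are always the top of what is
  left. Hence, by induction on \<open>y\<close>, both vectors have popped the same items up to row
  \<open>y\<close>.\<close>

lemma bracket_of_unique:
  assumes "bracket_of \<nu> \<mu> b" "bracket_of \<nu> \<mu> b'" "i < count_list \<nu> E"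
  shows "b i = b' i"
proof -
  let ?m = "count_list \<nu> E"
  have "{i. i < ?m \<and> b i \<le> y} = {i. i < ?m \<and> b' i \<le> y}" for y
  proof (induction y rule: less_induct)
    case (less y)
    have eq: "{i. i < ?m \<and> b i < y} = {i. i < ?m \<and> b' i < y}"
    proof -
      have "{i. i < ?m \<and> c i < y} = (\<Union>z<y. {i. i < ?m \<and> c i \<le> z})" for c :: "nat \<Rightarrow> nat"
        by auto
      then show ?thesis using less by simp
    qed
    let ?X = "{i. i < reach \<nu> y}"
    have bm: "i < ?m \<Longrightarrow> i < reach \<nu> (c i)" "i < j \<Longrightarrow> j < reach \<nu> (c i) \<Longrightarrow> c j \<le> c i"
      if "bracket_of \<nu> \<mu> c" for c i j
      using that by (auto simp: bracket_of_def bracket_vector_def)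
    have sub: "{i. i < ?m \<and> c i \<le> y} \<subseteq> ?X" if "bracket_of \<nu> \<mu> c" for c
      using bm(1)[OF that] reach_mono order_less_le_trans by fastforce
    have up: "j \<in> {i. i < ?m \<and> c i \<le> y}"
      if "bracket_of \<nu> \<mu> c" "i \<in> {i. i < ?m \<and> c i \<le> y}" "c i = y" "j \<in> ?X" "i < j" for c i j
      using that bm(2)[OF that(1)] reach_le[of \<nu> y] by auto
    have "{i. i < ?m \<and> b i = y} = {i. i < ?m \<and> b' i = y}"
    proof (rule upper_sets_eq)
      let ?S = "\<lambda>c. {i. i < ?m \<and> c i < y}"
      show "finite (?X - ?S b)" by simp
      show "{i. i < ?m \<and> b i = y} \<subseteq> ?X - ?S b" using sub[OF assms(1)] by auto
      show "{i. i < ?m \<and> b' i = y} \<subseteq> ?X - ?S b" using sub[OF assms(2)] unfolding eq by auto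
      have c: "card {i. i < ?m \<and> c i = y} = reach \<mu> y - card (?S c)" if "bracket_of \<nu> \<mu> c" for c
      proof -
        have "{i. i < ?m \<and> c i = y} = {i. i < ?m \<and> c i \<le> y} - ?S c" by auto
        then have "card {i. i < ?m \<and> c i = y} = card {i. i < ?m \<and> c i \<le> y} - card (?S c)"
          by (simp add: card_Diff_subset subset_iff)
        then show ?thesis using that by (simp add: bracket_of_def)
      qed
      show "card {i. i < ?m \<and> b i = y} = card {i. i < ?m \<and> b' i = y}"
        using c assms eq by simp
      show "j \<in> {i. i < ?m \<and> b i = y}"
        if "i \<in> {i. i < ?m \<and> b i = y}" "j \<in> ?X - ?S b" "i < j" for i j
        using up[OF assms(1), of i j] that by auto
      show "j \<in> {i. i < ?m \<and> b' i = y}"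
        if "i \<in> {i. i < ?m \<and> b' i = y}" "j \<in> ?X - ?S b" "i < j" for i j
        using up[OF assms(2), of i j] that unfolding eq by auto
    qed
    then show ?case using eq by (auto simp: set_eq_iff le_less)
  qed
  then have "b i \<le> y \<longleftrightarrow> b' i \<le> y" for y using assms(3) by (auto simp: set_eq_iff)
  then show ?thesis by (metis nle_le order_refl)
qed

lemma bracket_of_inj:
  assumes "bracket_of \<nu> \<mu> b" "bracket_of \<nu> \<mu>' b'" "\<And>i. i < count_list \<nu> E \<Longrightarrow> b i = b' i"
  shows "\<mu> = \<mu>'"
proof (rule path_eqI)
  show "count_list \<mu> N = count_list \<mu>' N"
    using assms(1,2) by (auto simp: bracket_of_def endpoint_def)
  have "{i. i < count_list \<nu> E \<and> b i \<le> y} = {i. i < count_list \<nu> E \<and> b' i \<le> y}" for y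
    using assms(3) by auto
  then show "reach \<mu> y = reach \<mu>' y" for y using assms(1,2) by (auto simp: bracket_of_def)
qed

lemma bracket_of_paths_above:
  assumes "bracket_of \<nu> \<mu> b"
  shows "\<mu> \<in> paths_above \<nu>"
proof -
  have "reach \<mu> y \<le> reach \<nu> y" for y
  proof -
    have "i < reach \<nu> y" if "i < count_list \<nu> E" "b i \<le> y" for i
      using assms that reach_mono[OF that(2), of \<nu>]
      by (auto simp: bracket_of_def bracket_vector_def intro: order_less_le_trans)
    then have "{i. i < count_list \<nu> E \<and> b i \<le> y} \<subseteq> {..<reach \<nu> y}" by auto
    then have "card {i. i < count_list \<nu> E \<and> b i \<le> y} \<le> reach \<nu> y"
      using card_mono[of "{..<reach \<nu> y}"] by simp
    then show ?thesis using assms by (simp add: bracket_of_def)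
  qed
  then show ?thesis using assms by (simp add: bracket_of_def paths_above_iff)
qed

section \<open>Rotations and the componentwise order\<close>

lemma length_path: "length (\<mu> :: path) = count_list \<mu> E + count_list \<mu> N"
proof (induction \<mu>)
  case (Cons s \<mu>)
  then show ?case by (cases s) auto
qed simp

lemma lattice_points_iff_take:
  "(x, y) \<in> lattice_points \<mu> \<longleftrightarrow> x + y \<le> length \<mu> \<and> endpoint (take (x + y) \<mu>) = (x, y)"
proof -
  show ?thesis
  proof
    assume "(x, y) \<in> lattice_points \<mu>"
    then obtain k where k: "k \<le> length \<mu>" "endpoint (take k \<mu>) = (x, y)"
      by (auto simp: lattice_points_def)
    then have "k = x + y" using length_path[of "take k \<mu>"] by (simp add: endpoint_def)
    then show "x + y \<le> length \<mu> \<and> endpoint (take (x + y) \<mu>) = (x, y)" using k by simp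
  next
    assume "x + y \<le> length \<mu> \<and> endpoint (take (x + y) \<mu>) = (x, y)"
    then show "(x, y) \<in> lattice_points \<mu>"
      unfolding lattice_points_def by (metis (mono_tags, lifting) mem_Collect_eq)
  qed
qed

text \<open>If the height of the stack does not change between rows \<open>y\<close> and \<open>y + 1\<close>, then the path
  rotates past a single north step; otherwise it returns to the same height as soon as the
  item \<open>reach \<nu> y\<close>, the first one to be pushed after row \<open>y\<close>, is popped.\<close>

definition next_row :: "path \<Rightarrow> (nat \<Rightarrow> nat) \<Rightarrow> nat \<Rightarrow> nat" where
  "next_row \<nu> b y = (if reach \<nu> (Suc y) = reach \<nu> y then Suc y else b (reach \<nu> y))"

lemma bracket_vectorD:
  assumes "bracket_vector \<nu> b"
  shows "i < count_list \<nu> E \<Longrightarrow> b i \<le> count_list \<nu> N"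
    and "i < count_list \<nu> E \<Longrightarrow> i < reach \<nu> (b i)"
    and "i < j \<Longrightarrow> j < reach \<nu> (b i) \<Longrightarrow> b j \<le> b i"
  using assms by (auto simp: bracket_vector_def)

lemma next_row_bounds:
  assumes b: "bracket_vector \<nu> b" and y: "y < count_list \<nu> N"
  shows "y < next_row \<nu> b y" "next_row \<nu> b y \<le> count_list \<nu> N"
proof -
  have "y < next_row \<nu> b y \<and> next_row \<nu> b y \<le> count_list \<nu> N"
  proof (cases "reach \<nu> (Suc y) = reach \<nu> y")
    case False
    then have "reach \<nu> y < count_list \<nu> E"
      using reach_Suc[of \<nu> y] reach_le[of \<nu> "Suc y"] by simp
    then show ?thesis using bracket_vectorD(1,2)[OF b] reach_mono[of "b (reach \<nu> y)" y \<nu>] False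
      by (metis leD le_less_linear next_row_def)
  qed (use y in \<open>simp add: next_row_def\<close>)
  then show "y < next_row \<nu> b y" "next_row \<nu> b y \<le> count_list \<nu> N" by auto
qed

text \<open>A row pops its items in decreasing order, so its least item \<open>i\<close> comes last,
  and it is this pop that gets delayed. Items pushed between row \<open>y\<close> and the new row
  lie at or above \<open>reach \<nu> y\<close> and are gone by then. An item below \<open>i\<close>
  that waits for \<open>i\<close> must likewise wait for \<open>reach \<nu> y\<close> if that item
  is pushed in row \<open>y + 1\<close>.\<close>

lemma bracket_vector_cover:
  assumes b: "bracket_vector \<nu> b" and y: "y < count_list \<nu> N"
    and i: "i < count_list \<nu> E" "b i = y" and first: "\<And>k. k < i \<Longrightarrow> b k \<noteq> y"
  shows "bracket_vector \<nu> (b(i := next_row \<nu> b y))"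
proof -
  let ?y' = "next_row \<nu> b y"
  note D = bracket_vectorD[OF b]
  note y' = next_row_bounds[OF b y]
  have "b j \<le> ?y'" if j: "i < j" "j < reach \<nu> ?y'" for j
  proof (cases "j < reach \<nu> y")
    case True
    then show ?thesis using D(3)[of i j] i j y' by simp
  next
    case False
    then have ne: "reach \<nu> (Suc y) \<noteq> reach \<nu> y" using j by (auto simp: next_row_def)
    then have "?y' = b (reach \<nu> y)" by (simp add: next_row_def)
    then show ?thesis using D(3)[of "reach \<nu> y" j] False j by (cases "j = reach \<nu> y") auto
  qed
  moreover have "?y' \<le> b k" if k: "k < i" "i < reach \<nu> (b k)" for k
  proof -
    have "y < b k" using D(3)[OF k] first[OF k(1)] i by simp
    moreover have "b (reach \<nu> y) \<le> b k" if "reach \<nu> (Suc y) \<noteq> reach \<nu> y"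
    proof (rule D(3))
      show "k < reach \<nu> y" using k D(2)[OF i(1)] i by simp
      show "reach \<nu> y < reach \<nu> (b k)"
        using reach_mono[of "Suc y" "b k" \<nu>] reach_Suc[of \<nu> y] that \<open>y < b k\<close> by simp
    qed
    ultimately show ?thesis by (auto simp: next_row_def)
  qed
  moreover have "i < reach \<nu> ?y'" using D(2)[OF i(1)] i reach_mono[of y ?y' \<nu>] y' by simp
  ultimately show ?thesis using D y' by (auto simp: bracket_vector_def)
qed

lemma reach_bracket_cover:
  fixes m i :: nat and b :: "nat \<Rightarrow> nat" and y y' :: nat
  assumes "i < m" "b i = y" "y < y'"
  shows "card {j. j < m \<and> b j \<le> z} =
    card {j. j < m \<and> (b(i := y')) j \<le> z} + (if y \<le> z \<and> z < y' then 1 else 0)"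
proof (cases "y \<le> z \<and> z < y'")
  case True
  then have "{j. j < m \<and> b j \<le> z} = insert i {j. j < m \<and> (b(i := y')) j \<le> z}" using assms by auto
  moreover have "i \<notin> {j. j < m \<and> (b(i := y')) j \<le> z}" using True by simp
  ultimately show ?thesis using True by simp
next
  case False
  then have "{j. j < m \<and> b j \<le> z} = {j. j < m \<and> (b(i := y')) j \<le> z}" using assms by auto
  then show ?thesis using False by simp
qed

lemma reach_shift:
  "reach (A @ [E] @ B @ C) z = reach (A @ B @ [E] @ C) z +
     (if count_list A N \<le> z \<and> z < count_list A N + count_list B N then 1 else 0)"
  by (auto simp: reach_append)

text \<open>\<open>(xW, y')\<close> is the point of row \<open>y'\<close> with the same
  \<open>horiz\<close> as the right end of row \<open>y\<close>. It lies on \<open>\<mu>\<close>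
  since all items pushed in between are popped by row \<open>y'\<close>. In the rows strictly
  between, \<open>reach \<nu> y\<close> is still on the stack, with everything below it untouched,
  so the stack is strictly higher than after row \<open>y\<close>.\<close>

lemma bracket_of_next_row:
  assumes bo: "bracket_of \<nu> \<mu> b" and y: "y < count_list \<nu> N"
  defines "y' \<equiv> next_row \<nu> b y"
  defines "xW \<equiv> reach \<mu> y + reach \<nu> y' - reach \<nu> y"
  shows "(xW, y') \<in> lattice_points \<mu>"
    and "\<And>q. y < q \<Longrightarrow> q < y' \<Longrightarrow> reach \<mu> q + reach \<nu> y < reach \<mu> y + reach \<nu> q"
proof -
  let ?m = "count_list \<nu> E"
  have b: "bracket_vector \<nu> b" and X: "\<And>z. reach \<mu> z = card {i. i < ?m \<and> b i \<le> z}"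
    and N: "count_list \<mu> N = count_list \<nu> N"
    using bo by (auto simp: bracket_of_def endpoint_def)
  note D = bracket_vectorD[OF b]
  note y' = next_row_bounds[OF b y, folded y'_def]
  have diff: "reach \<mu> z = reach \<mu> y + card {j. j < ?m \<and> y < b j \<and> b j \<le> z}" if "y \<le> z" for z
  proof -
    have "{i. i < ?m \<and> b i \<le> z} = {i. i < ?m \<and> b i \<le> y} \<union> {j. j < ?m \<and> y < b j \<and> b j \<le> z}"
      using that by auto
    moreover have "{i. i < ?m \<and> b i \<le> y} \<inter> {j. j < ?m \<and> y < b j \<and> b j \<le> z} = {}" by auto
    ultimately show ?thesis by (simp add: X card_Un_disjoint)
  qed
  show lt: "reach \<mu> q + reach \<nu> y < reach \<mu> y + reach \<nu> q" if q: "y < q" "q < y'" for q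
  proof -
    have ne: "reach \<nu> (Suc y) \<noteq> reach \<nu> y" using q by (auto simp: y'_def next_row_def)
    then have y'eq: "y' = b (reach \<nu> y)" by (simp add: y'_def next_row_def)
    have gt: "reach \<nu> y < reach \<nu> (Suc y)" using ne reach_Suc[of \<nu> y] by simp
    have "{j. j < ?m \<and> y < b j \<and> b j \<le> q} \<subseteq> {reach \<nu> y<..<reach \<nu> q}"
    proof
      fix j assume j: "j \<in> {j. j < ?m \<and> y < b j \<and> b j \<le> q}"
      have "j < reach \<nu> q" using D(2)[of j] j reach_mono[of "b j" q \<nu>] by auto
      moreover have "\<not> j < reach \<nu> y"
      proof
        assume "j < reach \<nu> y"
        moreover have "reach \<nu> y < reach \<nu> (b j)" using gt j reach_mono[of "Suc y" "b j" \<nu>] by auto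
        ultimately show False using D(3)[of j "reach \<nu> y"] j q y'eq by auto
      qed
      moreover have "j \<noteq> reach \<nu> y" using j q y'eq by auto
      ultimately show "j \<in> {reach \<nu> y<..<reach \<nu> q}" by auto
    qed
    then have "card {j. j < ?m \<and> y < b j \<and> b j \<le> q} \<le> card {reach \<nu> y<..<reach \<nu> q}"
      by (intro card_mono) auto
    then show ?thesis using diff[of q] q gt reach_mono[of "Suc y" q \<nu>] by simp
  qed
  have "xW \<le> reach \<mu> y'"
  proof (cases "reach \<nu> (Suc y) = reach \<nu> y")
    case True
    then show ?thesis using reach_Suc[of \<mu> y] by (simp add: xW_def y'_def next_row_def)
  next
    case False
    then have y'eq: "y' = b (reach \<nu> y)" by (simp add: y'_def next_row_def)
    have "{reach \<nu> y..<reach \<nu> y'} \<subseteq> {j. j < ?m \<and> y < b j \<and> b j \<le> y'}"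
    proof
      fix j assume j: "j \<in> {reach \<nu> y..<reach \<nu> y'}"
      then have "j < ?m" using reach_le[of \<nu> y'] by simp
      moreover have "y < b j" using D(2)[OF \<open>j < ?m\<close>] reach_mono[of "b j" y \<nu>] j by force
      moreover have "b j \<le> y'" using D(3)[of "reach \<nu> y" j] j y'eq
        by (cases "j = reach \<nu> y") auto
      ultimately show "j \<in> {j. j < ?m \<and> y < b j \<and> b j \<le> y'}" by simp
    qed
    then have "card {reach \<nu> y..<reach \<nu> y'} \<le> card {j. j < ?m \<and> y < b j \<and> b j \<le> y'}"
      by (intro card_mono) auto
    then show ?thesis using diff[of y'] y' by (simp add: xW_def)
  qed
  moreover have "reach \<mu> z \<le> xW" if "z < y'" for z
  proof (cases "z \<le> y")
    case True
    then show ?thesis using reach_mono[of z y \<mu>] reach_mono[of y y' \<nu>] y' by (simp add: xW_def)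
  next
    case False
    then show ?thesis using lt[of z] that reach_mono[of z y' \<nu>] by (simp add: xW_def)
  qed
  ultimately show "(xW, y') \<in> lattice_points \<mu>" using y' N by (simp add: lattice_points_iff)
qed

text \<open>Row \<open>y\<close> pops something, so an east step precedes its right end, which is
  the valley. The value of \<open>horiz\<close> first recurs in row
  \<open>next_row \<nu> b y\<close>, and moving the east step there delays the pop of
  \<open>i\<close>.\<close>

lemma rotation_at_valley:
  assumes bo: "bracket_of \<nu> \<mu> b" and y: "y < count_list \<nu> N"
    and i: "i < count_list \<nu> E" "b i = y" and first: "\<And>k. k < i \<Longrightarrow> b k \<noteq> y"
  obtains A B C where "\<mu> = A @ [E] @ B @ C" "B \<noteq> []" "hd B = N"
    "endpoint (A @ [E]) = (reach \<mu> y, y)"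
    "horiz \<nu> (endpoint (A @ [E] @ B)) = horiz \<nu> (endpoint (A @ [E]))"
    "\<And>k. 0 < k \<Longrightarrow> k < length B \<Longrightarrow>
       horiz \<nu> (endpoint (A @ [E] @ take k B)) \<noteq> horiz \<nu> (endpoint (A @ [E]))"
    "bracket_of \<nu> (A @ B @ [E] @ C) (b(i := next_row \<nu> b y))"
proof -
  let ?m = "count_list \<nu> E"
  define y' where "y' = next_row \<nu> b y"
  define xW where "xW = reach \<mu> y + reach \<nu> y' - reach \<nu> y"
  have b: "bracket_vector \<nu> b" and X: "\<And>z. reach \<mu> z = card {i. i < ?m \<and> b i \<le> z}"
    and cN: "count_list \<mu> N = count_list \<nu> N" and cE: "count_list \<mu> E = ?m"
    using bo by (auto simp: bracket_of_def endpoint_def)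
  note y' = next_row_bounds[OF b y, folded y'_def]
  have W: "(xW, y') \<in> lattice_points \<mu>"
    using bracket_of_next_row(1)[OF bo y] by (simp add: xW_def y'_def)
  have xW: "xW + reach \<nu> y = reach \<mu> y + reach \<nu> y'"
    using reach_mono[of y y' \<nu>] y' by (simp add: xW_def)
  have below: "reach \<mu> z < reach \<mu> y" if "z < y" for z
  proof -
    have "{i. i < ?m \<and> b i \<le> z} \<subseteq> {i. i < ?m \<and> b i \<le> y}" using that by auto
    moreover have "i \<in> {i. i < ?m \<and> b i \<le> y}" "i \<notin> {i. i < ?m \<and> b i \<le> z}"
      using i that by auto
    ultimately have "{i. i < ?m \<and> b i \<le> z} \<subset> {i. i < ?m \<and> b i \<le> y}" by blast
    then show ?thesis unfolding X by (intro psubset_card_mono) auto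
  qed
  have pos: "0 < reach \<mu> y"
  proof -
    have "i \<in> {i. i < ?m \<and> b i \<le> y}" using i by simp
    then show ?thesis unfolding X by (auto simp: card_gt_0_iff)
  qed
  \<comment> \<open>A point \<open>(x, y)\<close> is reached after \<open>x + y\<close> steps, so
    \<open>kV\<close> and \<open>kW\<close> are the numbers of steps leading to the valley and to
    the place where the east step is reinserted.\<close>
  define kV where "kV = reach \<mu> y + y"
  define kW where "kW = xW + y'"
  have V: "(reach \<mu> y, y) \<in> lattice_points \<mu>" "(reach \<mu> y - 1, y) \<in> lattice_points \<mu>"
    using y cN below by (fastforce simp: lattice_points_iff)+
  have kk: "kV < kW" using xW y' reach_mono[of y y' \<nu>] by (simp add: kV_def kW_def)
  have kWle: "kW \<le> length \<mu>" and eW: "endpoint (take kW \<mu>) = (xW, y')"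
    using W by (auto simp: lattice_points_iff_take kW_def)
  have eV: "endpoint (take kV \<mu>) = (reach \<mu> y, y)"
    using V(1) by (auto simp: lattice_points_iff_take kV_def)
  have eV': "endpoint (take (kV - 1) \<mu>) = (reach \<mu> y - 1, y)"
    using V(2) pos by (auto simp: lattice_points_iff_take kV_def)
  define A where "A = take (kV - 1) \<mu>"
  define B where "B = drop kV (take kW \<mu>)"
  define C where "C = drop kW \<mu>"
  have kV1: "kV = Suc (kV - 1)" using pos by (simp add: kV_def)
  have AE: "take kV \<mu> = A @ [E]"
  proof -
    have t: "take kV \<mu> = A @ [\<mu> ! (kV - 1)]"
      using kV1 kk kWle unfolding A_def by (metis Suc_le_eq less_le_trans less_or_eq_imp_le take_Suc_conv_app_nth)
    have "\<mu> ! (kV - 1) = E"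
    proof (cases "\<mu> ! (kV - 1)")
      case N
      then show ?thesis using eV eV' t by (simp add: endpoint_def A_def)
    qed
    then show ?thesis using t by simp
  qed
  have lB: "length B = kW - kV" using kWle by (simp add: B_def)
  have AEB: "take (kV + k) \<mu> = A @ [E] @ take k B" if "k \<le> length B" for k
  proof -
    have "take (kV + k) \<mu> = take kV \<mu> @ take k (drop kV \<mu>)" by (simp add: take_add)
    moreover have "take k (drop kV \<mu>) = take k B"
      using that lB by (simp add: B_def drop_take min.absorb1)
    ultimately show ?thesis using AE by simp
  qed
  have AEBW: "take kW \<mu> = A @ [E] @ B" using AEB[of "length B"] lB kk by simp
  have mu: "\<mu> = A @ [E] @ B @ C" using AEBW append_take_drop_id[of kW \<mu>] by (simp add: C_def)
  have Bne: "B \<noteq> []" using lB kk by auto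
  have pt: "endpoint (A @ [E] @ take k B) \<in> lattice_points \<mu>" if "k \<le> length B" for k
  proof -
    have "kV + k \<le> length \<mu>" using that lB kWle kk by simp
    then show ?thesis unfolding AEB[OF that, symmetric] lattice_points_def by blast
  qed
  have hdB: "hd B = N"
  proof (cases "hd B")
    case E
    then have "take (Suc 0) B = [E]" using Bne by (cases B) auto
    then have "endpoint (A @ [E] @ take (Suc 0) B) = (Suc (reach \<mu> y), y)"
      using eV unfolding AE by (auto simp: endpoint_def)
    then have "(Suc (reach \<mu> y), y) \<in> lattice_points \<mu>"
      using pt[of "Suc 0"] Bne by (simp add: Suc_le_eq)
    then show ?thesis by (auto simp: lattice_points_iff)
  qed
  have horiz_V: "horiz \<nu> (endpoint (A @ [E])) = int (reach \<nu> y) - int (reach \<mu> y)"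
    using eV y unfolding AE by (simp add: horiz_eq)
  have horiz_W: "horiz \<nu> (endpoint (A @ [E] @ B)) = int (reach \<nu> y) - int (reach \<mu> y)"
    using eW y' xW unfolding AEBW by (simp add: horiz_eq)
  have ne: "horiz \<nu> (endpoint (A @ [E] @ take k B)) \<noteq> horiz \<nu> (endpoint (A @ [E]))"
    if k: "0 < k" "k < length B" for k
  proof -
    obtain x q where xq: "endpoint (A @ [E] @ take k B) = (x, q)" by force
    then have lp: "(x, q) \<in> lattice_points \<mu>" using pt[of k] k by simp
    have "endpoint (take (kV + k) \<mu>) = (x, q)" using xq AEB[of k] k by simp
    moreover have "kV + k \<le> length \<mu>" using k lB kWle kk by simp
    ultimately have sum: "x + q = kV + k" using length_path[of "take (kV + k) \<mu>"] by (simp add: endpoint_def)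
    have q: "q \<le> count_list \<nu> N" "x \<le> reach \<mu> q" and prev: "\<And>z. z < q \<Longrightarrow> reach \<mu> z \<le> x"
      using lp cN by (auto simp: lattice_points_iff)
    have yq: "y < q"
    proof (rule ccontr)
      assume "\<not> y < q"
      then have "x \<le> reach \<mu> y" "q \<le> y" using q reach_mono[of q y \<mu>] by auto
      then show False using sum k by (simp add: kV_def)
    qed
    have qy': "q \<le> y'"
    proof (rule ccontr)
      assume "\<not> q \<le> y'"
      then have "xW \<le> x" using prev[of y'] W by (auto simp: lattice_points_iff)
      then show False using sum k lB \<open>\<not> q \<le> y'\<close> by (simp add: kW_def)
    qed
    \<comment> \<open>Before \<open>W\<close> the value of \<open>horiz\<close> is strictly larger:
      in row \<open>y'\<close> because the point is still left of \<open>W\<close>, in the lower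
      rows because the stack is higher.\<close>
    have "x + reach \<nu> y < reach \<mu> y + reach \<nu> q"
    proof (cases "q = y'")
      case True
      then show ?thesis using xW sum k lB by (simp add: kW_def)
    next
      case False
      then show ?thesis using bracket_of_next_row(2)[OF bo y, of q] yq qy' q by (simp add: y'_def)
    qed
    then show ?thesis using q horiz_V xq by (simp add: horiz_eq)
  qed
  have cA: "count_list A N = y" using eV' by (simp add: A_def endpoint_def)
  have cB: "y + count_list B N = y'" using eW cA unfolding AEBW by (simp add: endpoint_def)
  have "bracket_of \<nu> (A @ B @ [E] @ C) (b(i := y'))"
    unfolding bracket_of_def
  proof (intro conjI allI)
    show "bracket_vector \<nu> (b(i := y'))"
      using bracket_vector_cover[OF b y i first] by (simp add: y'_def)
    have "endpoint (A @ B @ [E] @ C) = endpoint \<mu>" unfolding mu endpoint_def by simp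
    then show "endpoint (A @ B @ [E] @ C) = endpoint \<nu>" using bo by (simp add: bracket_of_def)
    show "reach (A @ B @ [E] @ C) z = card {j. j < ?m \<and> (b(i := y')) j \<le> z}" for z
      using reach_shift[of A B C z] reach_bracket_cover[of i ?m b y y' z, OF i y'(1)] X[of z] cA cB
      unfolding mu[symmetric] by (simp split: if_splits)
  qed
  then show ?thesis using that mu Bne hdB eV horiz_V horiz_W ne unfolding AE y'_def by metis
qed

lemma reach_0_hd_N: "B \<noteq> [] \<Longrightarrow> hd B = N \<Longrightarrow> reach (B @ C) 0 = 0"
  by (cases B) auto

lemma rotation_bracket:
  assumes bo: "bracket_of \<nu> \<mu> b" and rot: "rotation \<nu> \<mu> \<mu>'"
  shows "\<exists>b'. bracket_of \<nu> \<mu>' b' \<and> (\<forall>i. b i \<le> b' i)"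
proof -
  let ?m = "count_list \<nu> E"
  obtain A B C where mu: "\<mu> = A @ [E] @ B @ C" and mu': "\<mu>' = A @ B @ [E] @ C"
    and B: "B \<noteq> []" "hd B = N"
    and W: "horiz \<nu> (endpoint (A @ [E] @ B)) = horiz \<nu> (endpoint (A @ [E]))"
    and ne: "\<And>k. 0 < k \<Longrightarrow> k < length B \<Longrightarrow>
       horiz \<nu> (endpoint (A @ [E] @ take k B)) \<noteq> horiz \<nu> (endpoint (A @ [E]))"
    using rot unfolding rotation_def by blast
  define y where "y = count_list A N"
  have b: "bracket_vector \<nu> b" and X: "\<And>z. reach \<mu> z = card {i. i < ?m \<and> b i \<le> z}"
    and cN: "count_list \<mu> N = count_list \<nu> N"
    using bo by (auto simp: bracket_of_def endpoint_def)
  have "count_list B N > 0" using B by (cases B) auto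
  then have y: "y < count_list \<nu> N" using cN mu y_def by simp
  have ry: "reach \<mu> y = Suc (count_list A E)"
    unfolding mu y_def by (simp add: reach_append[of A] reach_0_hd_N[OF B])
  have "\<exists>i. i < ?m \<and> b i = y"
  proof (rule ccontr)
    assume no: "\<nexists>i. i < ?m \<and> b i = y"
    show False
    proof (cases y)
      case 0
      then have "{i. i < ?m \<and> b i \<le> y} = {}" using no by auto
      then have "reach \<mu> y = 0" using X[of y] by simp
      then show ?thesis using ry by simp
    next
      case (Suc z)
      then have "{i. i < ?m \<and> b i \<le> y} = {i. i < ?m \<and> b i \<le> z}" using no by (auto simp: le_Suc_eq)
      then have "reach \<mu> y = reach \<mu> z" by (simp add: X)
      moreover have "reach \<mu> z = reach A z" unfolding mu using Suc by (simp add: reach_append[of A] y_def[symmetric])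
      ultimately show ?thesis using ry reach_le[of A z] by simp
    qed
  qed
  then obtain i where i: "i < ?m" "b i = y" and first: "\<And>k. k < i \<Longrightarrow> b k \<noteq> y"
    using exists_least_iff[of "\<lambda>i. i < ?m \<and> b i = y"] by (metis less_trans)
  obtain A' B' C' where 1: "\<mu> = A' @ [E] @ B' @ C'" and B': "B' \<noteq> []" "hd B' = N"
    and e: "endpoint (A' @ [E]) = (reach \<mu> y, y)"
    and W': "horiz \<nu> (endpoint (A' @ [E] @ B')) = horiz \<nu> (endpoint (A' @ [E]))"
    and ne': "\<And>k. 0 < k \<Longrightarrow> k < length B' \<Longrightarrow>
       horiz \<nu> (endpoint (A' @ [E] @ take k B')) \<noteq> horiz \<nu> (endpoint (A' @ [E]))"
    and bo': "bracket_of \<nu> (A' @ B' @ [E] @ C') (b(i := next_row \<nu> b y))"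
    using rotation_at_valley[OF bo y i first] by metis
  \<comment> \<open>Both splittings have the same valley. Then neither of \<open>B\<close> and
    \<open>B'\<close> is a proper prefix of the other, since \<open>horiz\<close> would return too
    early.\<close>
  have "length A = length A'" using e ry by (simp add: length_path[of A] length_path[of A'] endpoint_def y_def)
  then have A: "A = A'" "B @ C = B' @ C'" using mu 1 by auto
  have "\<not> length B < length B'"
  proof
    assume l: "length B < length B'"
    then have "take (length B) B' = B" using A(2) by (metis append_eq_append_conv_if less_or_eq_imp_le)
    then show False using ne'[of "length B"] l W B(1) A(1) by simp
  qed
  moreover have "\<not> length B' < length B"
  proof
    assume l: "length B' < length B"
    then have "take (length B') B = B'" using A(2) by (metis append_eq_append_conv_if less_or_eq_imp_le)
    then show False using ne[of "length B'"] l W' B'(1) A(1) by simp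
  qed
  ultimately have "B = B'" "C = C'" using A(2) by auto
  then have "bracket_of \<nu> \<mu>' (b(i := next_row \<nu> b y))" using bo' A mu' by simp
  moreover have "\<forall>j. b j \<le> (b(i := next_row \<nu> b y)) j" using next_row_bounds(1)[OF b y] i by simp
  ultimately show ?thesis by blast
qed

text \<open>The entry to raise belongs to the least item \<open>k\<close> popped in row
  \<open>b i\<close>. If \<open>b' k\<close> were still that row, \<open>b'\<close> would have to
  pop \<open>i\<close>, which is at or above \<open>k\<close>, no later, contradicting
  \<open>b i < b' i\<close>. The new value does not overshoot \<open>b' k\<close>: in
  \<open>b'\<close> too, an item pushed right after row \<open>y\<close> is popped no later than
  \<open>k\<close>.\<close>

lemma ex_rotation_below:
  assumes bo: "bracket_of \<nu> \<mu> b" and bo': "bracket_of \<nu> \<mu>' b'"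
    and le: "\<And>i. i < count_list \<nu> E \<Longrightarrow> b i \<le> b' i"
    and ne: "i < count_list \<nu> E" "b i \<noteq> b' i"
  shows "\<exists>\<mu>'' i y. rotation \<nu> \<mu> \<mu>'' \<and> i < count_list \<nu> E \<and> b i < y \<and> y \<le> b' i \<and>
    bracket_of \<nu> \<mu>'' (b(i := y))"
proof -
  let ?m = "count_list \<nu> E"
  have b: "bracket_vector \<nu> b" and b': "bracket_vector \<nu> b'"
    using bo bo' by (auto simp: bracket_of_def)
  note D = bracket_vectorD[OF b] and D' = bracket_vectorD[OF b']
  define y where "y = b i"
  obtain k where k: "k < ?m" "b k = y" and first: "\<And>j. j < k \<Longrightarrow> b j \<noteq> y"
    using exists_least_iff[of "\<lambda>k. k < ?m \<and> b k = y"] ne(1) y_def by (metis less_trans)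
  have ki: "k \<le> i" using first[of i] y_def by (cases "k \<le> i") auto
  have "i < reach \<nu> y" using D(2)[OF ne(1)] y_def by simp
  have less: "y < b' k"
  proof (rule ccontr)
    assume "\<not> y < b' k"
    then have eq: "b' k = y" using le[OF k(1)] k by simp
    then have "b' i \<le> y" using D'(3)[of k i] ki \<open>i < reach \<nu> y\<close> by (cases "k = i") auto
    then show False using le[OF ne(1)] ne(2) y_def by simp
  qed
  have y: "y < count_list \<nu> N" using less D'(1)[OF k(1)] by simp
  have le': "next_row \<nu> b y \<le> b' k"
  proof (cases "reach \<nu> (Suc y) = reach \<nu> y")
    case True
    then show ?thesis using less by (simp add: next_row_def)
  next
    case False
    then have lt: "reach \<nu> y < reach \<nu> (b' k)"
      using reach_Suc[of \<nu> y] reach_mono[of "Suc y" "b' k" \<nu>] less by simp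
    have "b (reach \<nu> y) \<le> b' (reach \<nu> y)" using le lt reach_le[of \<nu> "b' k"] by simp
    also have "\<dots> \<le> b' k" using D'(3)[of k "reach \<nu> y"] lt D(2)[OF k(1)] k by simp
    finally show ?thesis using False by (simp add: next_row_def)
  qed
  obtain A B C where 1: "\<mu> = A @ [E] @ B @ C" and B: "B \<noteq> []" "hd B = N"
    and W: "horiz \<nu> (endpoint (A @ [E] @ B)) = horiz \<nu> (endpoint (A @ [E]))"
    and n: "\<And>k. 0 < k \<Longrightarrow> k < length B \<Longrightarrow>
       horiz \<nu> (endpoint (A @ [E] @ take k B)) \<noteq> horiz \<nu> (endpoint (A @ [E]))"
    and bo2: "bracket_of \<nu> (A @ B @ [E] @ C) (b(k := next_row \<nu> b y))"
    using rotation_at_valley[OF bo y k first] by metis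
  have "rotation \<nu> \<mu> (A @ B @ [E] @ C)"
    unfolding rotation_def
  proof (intro conjI exI)
    show "\<mu> \<in> paths_above \<nu>" "A @ B @ [E] @ C \<in> paths_above \<nu>"
      using bo bo2 bracket_of_paths_above by auto
    show "\<mu> = A @ [E] @ B @ C" by (rule 1)
  qed (use B W n in auto)
  then show ?thesis using bo2 k next_row_bounds(1)[OF b y] le' by blast
qed

theorem nu_tamari_le_iff:
  assumes "bracket_of \<nu> \<mu> b" "bracket_of \<nu> \<mu>' b'"
  shows "nu_tamari_le \<nu> \<mu> \<mu>' \<longleftrightarrow> (\<forall>i < count_list \<nu> E. b i \<le> b' i)"
proof
  assume "nu_tamari_le \<nu> \<mu> \<mu>'"
  then have "\<exists>c. bracket_of \<nu> \<mu>' c \<and> (\<forall>i. b i \<le> c i)"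
    unfolding nu_tamari_le_def
  proof (induction rule: rtranclp_induct)
    case base
    then show ?case using assms(1) by blast
  next
    case (step \<sigma> \<tau>)
    then obtain c where c: "bracket_of \<nu> \<sigma> c" "\<forall>i. b i \<le> c i" by blast
    then obtain d where "bracket_of \<nu> \<tau> d" "\<forall>i. c i \<le> d i"
      using rotation_bracket step by blast
    then show ?case using c order_trans by blast
  qed
  then show "\<forall>i < count_list \<nu> E. b i \<le> b' i" using assms(2) bracket_of_unique by metis
next
  let ?m = "count_list \<nu> E"
  assume "\<forall>i < ?m. b i \<le> b' i"
  then show "nu_tamari_le \<nu> \<mu> \<mu>'"
    using assms(1)
  proof (induction "\<Sum>i<?m. b' i - b i" arbitrary: \<mu> b rule: less_induct)
    case less
    show ?case
    proof (cases "\<forall>i<?m. b i = b' i")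
      case True
      then have "\<mu> = \<mu>'" using bracket_of_inj[OF less.prems(2) assms(2)] by simp
      then show ?thesis by (simp add: nu_tamari_le_def)
    next
      case False
      then obtain \<tau> i y where t: "rotation \<nu> \<mu> \<tau>" "i < ?m" "b i < y" "y \<le> b' i"
        "bracket_of \<nu> \<tau> (b(i := y))"
        using ex_rotation_below[OF less.prems(2) assms(2)] less.prems(1) by metis
      \<comment> \<open>The total gap between the vectors shrinks, since the rotation raises one
        entry without passing \<open>b'\<close>.\<close>
      have "(\<Sum>j<?m. b' j - (b(i := y)) j) < (\<Sum>j<?m. b' j - b j)"
        using t by (intro sum_strict_mono_ex1) (auto intro!: bexI[of _ i])
      moreover have "\<forall>j<?m. (b(i := y)) j \<le> b' j" using less.prems(1) t by simp
      ultimately have "nu_tamari_le \<nu> \<tau> \<mu>'" using less.hyps t(5) by blast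
      then show ?thesis using t(1) unfolding nu_tamari_le_def
        by (rule converse_rtranclp_into_rtranclp[rotated])
    qed
  qed
qed

section \<open>Permutations and parents\<close>

text \<open>Position \<open>0\<close>, alone in region \<open>0\<close>, stands for the root of the tree, so that \<open>n + 1\<close> is
  the letter read there.\<close>

locale regions =
  fixes n :: nat and reg row :: "nat \<Rightarrow> nat"
  assumes reg_mono: "i \<le> j \<Longrightarrow> j \<le> n \<Longrightarrow> reg i \<le> reg j"
    and reg_pos: "0 < i \<Longrightarrow> i \<le> n \<Longrightarrow> reg 0 < reg i"
    and row_le_iff: "p \<le> n \<Longrightarrow> q \<le> n \<Longrightarrow>
      row p \<le> row q \<longleftrightarrow> reg q < reg p \<or> (reg p = reg q \<and> p \<le> q)"
begin

lemma reg_less_imp: "reg i < reg j \<Longrightarrow> i \<le> n \<Longrightarrow> i < j"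
  using reg_mono[of j i] by (meson leD not_le_imp_less)

definition avoiding :: "(nat \<Rightarrow> nat) \<Rightarrow> bool" where
  "avoiding w \<longleftrightarrow> w permutes {1..n} \<and>
     (\<forall>i j. 1 \<le> i \<longrightarrow> i < j \<longrightarrow> j \<le> n \<longrightarrow> reg i = reg j \<longrightarrow> w i < w j) \<and>
     \<not> (\<exists>i j k. 1 \<le> i \<and> i < j \<and> j < k \<and> k \<le> n \<and> reg i \<noteq> reg j \<and> reg j \<noteq> reg k \<and>
          reg i \<noteq> reg k \<and> w i < w j \<and> w i = w k + 1)"

definition ext :: "(nat \<Rightarrow> nat) \<Rightarrow> nat \<Rightarrow> nat" where
  "ext w = w(0 := Suc n)"

definition par :: "(nat \<Rightarrow> nat) \<Rightarrow> nat \<Rightarrow> nat" where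
  "par w k = arg_min (ext w) (\<lambda>p. p < k \<and> ext w k < ext w p)"

context
  fixes w :: "nat \<Rightarrow> nat"
  assumes perm: "w permutes {1..n}"
begin

lemma ext_in: "1 \<le> i \<Longrightarrow> i \<le> n \<Longrightarrow> ext w i = w i \<and> 1 \<le> w i \<and> w i \<le> n"
  using permutes_in_image[OF perm, of i] by (auto simp: ext_def)

lemma ext_inj: "i \<le> n \<Longrightarrow> j \<le> n \<Longrightarrow> ext w i = ext w j \<Longrightarrow> i = j"
  using ext_in[of i] ext_in[of j] permutes_inj[OF perm]
  by (cases "i = 0"; cases "j = 0") (auto simp: ext_def dest: injD)

lemma par:
  assumes "1 \<le> k" "k \<le> n"
  shows "par w k < k" "ext w k < ext w (par w k)"
    "\<And>j. j < k \<Longrightarrow> ext w k < ext w j \<Longrightarrow> ext w (par w k) \<le> ext w j"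
proof -
  have "0 < k \<and> ext w k < ext w 0" using ext_in[of k] assms by (auto simp: ext_def)
  from arg_min_nat_lemma[of "\<lambda>p. p < k \<and> ext w k < ext w p" 0 "ext w", OF this]
  show "par w k < k" "ext w k < ext w (par w k)"
    "\<And>j. j < k \<Longrightarrow> ext w k < ext w j \<Longrightarrow> ext w (par w k) \<le> ext w j"
    by (auto simp: par_def)
qed

lemma par_eqI:
  assumes "1 \<le> k" "k \<le> n" "p < k" "ext w k < ext w p"
    "\<And>j. j < k \<Longrightarrow> ext w k < ext w j \<Longrightarrow> ext w p \<le> ext w j"
  shows "par w k = p"
proof (rule ext_inj)
  show "ext w (par w k) = ext w p"
    using par[OF assms(1,2)] assms(3-5) by (meson le_antisym)
qed (use par(1)[OF assms(1,2)] assms in auto)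

end

section \<open>Parents and inversions of an avoiding permutation\<close>

lemma avoiding_permutes: "avoiding w \<Longrightarrow> w permutes {1..n}"
  by (simp add: avoiding_def)

lemma ext_incr:
  assumes "avoiding w" "i < j" "j \<le> n" "reg i = reg j"
  shows "ext w i < ext w j"
proof -
  have "i \<noteq> 0" using reg_pos[of j] assms by (metis less_irrefl)
  then show ?thesis using assms by (auto simp: avoiding_def ext_def)
qed

lemma reg_less_of_inversion:
  assumes "avoiding w" "i < j" "j \<le> n" "ext w j < ext w i"
  shows "reg i < reg j"
  using ext_incr[OF assms(1-3)] reg_mono[of i j] assms by (metis le_neq_implies_less less_asym less_imp_le)

text \<open>If an inverted \<open>j\<close> had a lower row, its region would lie strictly between
  those of the parent \<open>p\<close> and of \<open>k\<close>. By the choice of \<open>p\<close>,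
  no letter strictly between \<open>w k\<close> and \<open>w p\<close> is read before
  \<open>k\<close>. So \<open>w p - 1\<close> occurs at some \<open>q \<ge> k\<close>, and
  \<open>p < j < q\<close> is a forbidden pattern.\<close>

lemma row_par_le:
  assumes av: "avoiding w" and k: "1 \<le> k" "k \<le> n" and j: "j < k" "ext w k < ext w j"
  shows "row (par w k) \<le> row j"
proof (rule ccontr)
  let ?p = "par w k"
  note perm = avoiding_permutes[OF av]
  note p = par[OF perm k]
  assume "\<not> row ?p \<le> row j"
  then have nr: "\<not> (reg j < reg ?p \<or> (reg ?p = reg j \<and> ?p \<le> j))"
    using row_le_iff[of ?p j] p(1) j k by simp
  have wle: "ext w ?p \<le> ext w j" using p(3)[OF j] .
  have "\<not> (reg ?p = reg j \<and> j < ?p)"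
    using ext_incr[OF av, of j ?p] wle p(1) k by auto
  then have rpj: "reg ?p < reg j" using nr by (meson linorder_neqE_nat not_le_imp_less)
  then have pj: "?p < j" using reg_less_imp[of ?p j] p(1) k by simp
  have rjk: "reg j < reg k" using reg_less_of_inversion[OF av j(1) k(2) j(2)] .
  have wlt: "ext w ?p < ext w j" using wle pj ext_inj[OF perm, of ?p j] p(1) j k by fastforce
  then have p0: "?p \<noteq> 0" using ext_in[OF perm, of j] pj j k
    by (cases "?p = 0") (simp_all add: ext_def)
  have wk: "1 \<le> w k" "w k < w ?p" "w ?p \<le> n"
    using ext_in[OF perm k] ext_in[OF perm, of ?p] p0 p k by auto
  define q where "q = inv w (w ?p - 1)"
  have "w ?p - 1 \<in> {1..n}" using wk by auto
  then have q: "w q = w ?p - 1" "q \<in> {1..n}"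
    unfolding q_def using permutes_inverses[OF perm] permutes_in_image[OF permutes_inv[OF perm]] by auto
  have "k \<le> q"
  proof (rule ccontr)
    assume "\<not> k \<le> q"
    then have "q < k" by simp
    moreover have "w q \<noteq> w k" using permutes_inj[OF perm] \<open>\<not> k \<le> q\<close> by (auto dest: injD)
    ultimately have "ext w k < ext w q"
      using q wk ext_in[OF perm k] ext_in[OF perm, of q] by auto
    then have "ext w ?p \<le> ext w q" using p(3)[OF \<open>q < k\<close>] by simp
    then show False using q wk ext_in[OF perm, of q] ext_in[OF perm, of ?p] p0 p(1) k by auto
  qed
  then have "reg k \<le> reg q" using reg_mono q by simp
  moreover have "w ?p = w q + 1" using q wk by simp
  moreover have "w ?p < w j"
    using wlt ext_in[OF perm, of ?p] ext_in[OF perm, of j] p0 pj j k by auto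
  ultimately have "1 \<le> ?p \<and> ?p < j \<and> j < q \<and> q \<le> n \<and> reg ?p \<noteq> reg j \<and> reg j \<noteq> reg q \<and>
          reg ?p \<noteq> reg q \<and> w ?p < w j \<and> w ?p = w q + 1"
    using p0 pj j \<open>k \<le> q\<close> q rpj rjk by auto
  then show False using av unfolding avoiding_def by blast
qed

lemma reg_par_less:
  assumes "avoiding w" "1 \<le> k" "k \<le> n"
  shows "reg (par w k) < reg k"
  using reg_less_of_inversion[OF assms(1) _ assms(3)] par[OF avoiding_permutes[OF assms(1)] assms(2,3)] by simp

text \<open>This is the stack discipline for positions. The parent \<open>p\<close> of
  \<open>k\<close> is inverted with \<open>j\<close>: otherwise the letter of \<open>j\<close>
  exceeds that of \<open>p\<close>, hence that of \<open>k\<close>, and \<open>row_par_le\<close>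
  puts \<open>p\<close> in a row no higher than \<open>j\<close>, although the region of
  \<open>p\<close> is earlier.\<close>

lemma row_par_mono:
  assumes av: "avoiding w" and k: "1 \<le> k" "k \<le> n" and j: "1 \<le> j" "j < k" "reg (par w k) < reg j"
  shows "row (par w j) \<le> row (par w k)"
proof -
  let ?p = "par w k"
  note perm = avoiding_permutes[OF av]
  note p = par[OF perm k]
  have pj: "?p < j" using reg_less_imp j p(1) k by simp
  have "ext w j < ext w ?p"
  proof (rule ccontr)
    assume "\<not> ext w j < ext w ?p"
    then have "ext w k < ext w j" using p(2) by simp
    then have "row ?p \<le> row j" using row_par_le[OF av k j(2)] by simp
    then show False using row_le_iff[of ?p j] j p(1) k by simp
  qed
  then show ?thesis using row_par_le[OF av j(1) _ pj] j k by simp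
qed

text \<open>Forward: the parent of \<open>k\<close> in \<open>u\<close> is also inverted with
  \<open>k\<close> in \<open>v\<close>, so \<open>row_par_le\<close> applies. Backward: an inversion
  \<open>(j, k)\<close> of \<open>u\<close> is followed up the parents in \<open>v\<close>. The next
  one, \<open>par v k\<close>, is in the region of \<open>j\<close> and weakly before
  \<open>j\<close>, or in a later region; then it is itself inverted with \<open>j\<close> in
  \<open>u\<close>, and the induction applies.\<close>

theorem Inv_subset_iff:
  assumes u: "avoiding u" and v: "avoiding v"
  shows "Inv n u \<subseteq> Inv n v \<longleftrightarrow> (\<forall>k. 1 \<le> k \<longrightarrow> k \<le> n \<longrightarrow> row (par v k) \<le> row (par u k))"
proof
  note pu = avoiding_permutes[OF u] and pv = avoiding_permutes[OF v]
  assume sub: "Inv n u \<subseteq> Inv n v"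
  show "\<forall>k. 1 \<le> k \<longrightarrow> k \<le> n \<longrightarrow> row (par v k) \<le> row (par u k)"
  proof (intro allI impI)
    fix k assume k: "1 \<le> k" "k \<le> n"
    note p = par[OF pu k]
    have "ext v k < ext v (par u k)"
    proof (cases "par u k = 0")
      case True
      then show ?thesis using ext_in[OF pv k] by (simp add: ext_def)
    next
      case False
      then have "(par u k, k) \<in> Inv n u"
        using p k ext_in[OF pu k] ext_in[OF pu, of "par u k"] by (simp add: Inv_def)
      then have "(par u k, k) \<in> Inv n v" using sub by blast
      then show ?thesis using ext_in[OF pv k] ext_in[OF pv, of "par u k"] k by (simp add: Inv_def)
    qed
    then show "row (par v k) \<le> row (par u k)" using row_par_le[OF v k p(1)] by simp
  qed
next
  note pu = avoiding_permutes[OF u] and pv = avoiding_permutes[OF v]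
  assume le: "\<forall>k. 1 \<le> k \<longrightarrow> k \<le> n \<longrightarrow> row (par v k) \<le> row (par u k)"
  have "ext v k < ext v j" if "1 \<le> j" "j < k" "k \<le> n" "ext u k < ext u j" for j k
    using that
  proof (induction k rule: less_induct)
    case (less k)
    let ?q = "par v k"
    have k: "1 \<le> k" "k \<le> n" using less.prems by auto
    note q = par[OF pv k]
    have "row ?q \<le> row (par u k)" using le k by simp
    also have uj: "\<dots> \<le> row j" using row_par_le[OF u k] less.prems by simp
    finally have "reg j < reg ?q \<or> (reg ?q = reg j \<and> ?q \<le> j)"
      using row_le_iff[of ?q j] q(1) less.prems by simp
    then show ?case
    proof
      assume "reg ?q = reg j \<and> ?q \<le> j"
      then have "ext v ?q \<le> ext v j" using ext_incr[OF v, of ?q j] less.prems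
        by (cases "?q = j") auto
      then show ?thesis using q(2) by simp
    next
      assume rjq: "reg j < reg ?q"
      then have jq: "j < ?q" using reg_less_imp less.prems by simp
      have "ext u ?q < ext u j"
      proof (rule ccontr)
        assume "\<not> ext u ?q < ext u j"
        then have lt: "ext u j < ext u ?q" using ext_inj[OF pu, of j ?q] jq q(1) k less.prems by fastforce
        text \<open>Going up from \<open>u k\<close> to \<open>u j\<close>, the values are first taken in regions after that of
          \<open>?q\<close>; let \<open>u m\<close> be the first one which is not.\<close>
        let ?P = "\<lambda>x. u k < x \<and> x \<le> u j \<and> reg (inv u x) \<le> reg ?q"
        have uk: "u k < u j" "1 \<le> u k" "u j \<le> n"
          using less.prems ext_in[OF pu k] ext_in[OF pu, of j] by auto
        have invu: "inv u (u i) = i" for i using permutes_inverses[OF pu] by simp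
        have "?P (u j)" using uk rjq invu by simp
        define x where "x = (LEAST x. ?P x)"
        have x: "?P x" unfolding x_def by (rule LeastI, rule \<open>?P (u j)\<close>)
        have minx: "\<not> ?P y" if "y < x" for y using not_less_Least that unfolding x_def by blast
        define m where "m = inv u x"
        have um: "u m = x" unfolding m_def using permutes_inverses[OF pu] by simp
        have "x \<in> {1..n}" using x uk by auto
        then have m: "1 \<le> m" "m \<le> n" unfolding m_def
          using permutes_in_image[OF permutes_inv[OF pu], of x] by auto
        have rqk: "reg ?q < reg k" using reg_par_less[OF v k] .
        have "reg m \<le> reg ?q" using x m_def by simp
        then have mk: "m < k" using reg_less_imp[of m k] rqk m by simp
        have q1: "1 \<le> ?q" using jq by simp
        have uq: "u j < u ?q" using lt ext_in[OF pu, of ?q] ext_in[OF pu, of j] q1 q(1) k less.prems by auto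
        show False
        proof (cases "reg m = reg ?q")
          \<comment> \<open>Here \<open>m\<close> is inverted with \<open>k\<close> in
            \<open>u\<close> but has a lower row than \<open>?q\<close>, whereas
            \<open>row ?q\<close> is bounded by \<open>row (par u k)\<close>, hence by
            \<open>row m\<close>.\<close>
          case True
          have "m < ?q"
          proof (rule ccontr)
            assume "\<not> m < ?q"
            then have "u ?q \<le> u m" using u True q1 m unfolding avoiding_def
              by (metis le_eq_less_or_eq not_less)
            then show False using um x uq by simp
          qed
          have "ext u k < ext u m" using um x ext_in[OF pu k] ext_in[OF pu m] by simp
          then have "row (par u k) \<le> row m" using row_par_le[OF u k mk] by simp
          then have "row ?q \<le> row m" using le k order_trans by blast
          then show False using row_le_iff[of ?q m] True \<open>m < ?q\<close> q(1) k m by simp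
        next
          \<comment> \<open>The value just below \<open>x\<close> still sits in a region after that
            of \<open>?q\<close>, at position \<open>l\<close>; so \<open>m < ?q < l\<close> is a
            forbidden pattern.\<close>
          case False
          then have rm: "reg m < reg ?q" using \<open>reg m \<le> reg ?q\<close> by simp
          define l where "l = inv u (x - 1)"
          have "x - 1 \<in> {1..n}" using x uk by auto
          then have l: "u l = x - 1" "1 \<le> l" "l \<le> n"
            unfolding l_def using permutes_in_image[OF permutes_inv[OF pu], of "x - 1"]
              permutes_inverses[OF pu] by auto
          have "reg ?q < reg l"
          proof (cases "l = k")
            case False
            then have "u l \<noteq> u k" using permutes_inj[OF pu] by (auto dest: injD)
            then show ?thesis using minx[of "x - 1"] x l l_def by auto
          qed (use rqk in simp)
          moreover have "m < ?q" using reg_less_imp[OF rm] m by simp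
          moreover have "?q < l" using reg_less_imp[OF \<open>reg ?q < reg l\<close>] q(1) k by simp
          moreover have "u m < u ?q" using um x uq by simp
          moreover have "u m = u l + 1" using um l x by simp
          ultimately have "1 \<le> m \<and> m < ?q \<and> ?q < l \<and> l \<le> n \<and> reg m \<noteq> reg ?q \<and> reg ?q \<noteq> reg l \<and>
             reg m \<noteq> reg l \<and> u m < u ?q \<and> u m = u l + 1"
            using m l rm by auto
          then show False using u unfolding avoiding_def by blast
        qed
      qed
      then have "ext v ?q < ext v j" using less.IH[OF q(1)] less.prems jq q(1) k by simp
      then show ?thesis using q(2) by simp
    qed
  qed
  then show "Inv n u \<subseteq> Inv n v" using ext_in[OF pu] ext_in[OF pv] by (force simp: Inv_def)
qed

end

section \<open>Reconstruction of an avoiding permutation from its parent map\<close>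

context regions
begin

text \<open>The conditions on a bracket vector, with \<open>row (P k)\<close> as the entry of the
  item of \<open>k\<close>: the item has been pushed when it is popped, and items pushed on top of
  it by then (smaller positions) are popped no later.\<close>

definition parent_map :: "(nat \<Rightarrow> nat) \<Rightarrow> bool" where
  "parent_map P \<longleftrightarrow>
     (\<forall>k. 1 \<le> k \<longrightarrow> k \<le> n \<longrightarrow> P k \<le> n \<and> reg (P k) < reg k) \<and>
     (\<forall>j k. 1 \<le> j \<longrightarrow> j < k \<longrightarrow> k \<le> n \<longrightarrow> reg (P k) < reg j \<longrightarrow> row (P j) \<le> row (P k))"

text \<open>\<open>under P j k\<close>: some proper ancestor of \<open>k\<close> lies in the region of \<open>j\<close>, weakly before \<open>j\<close>.
  These are the inversions of the permutation whose parent map is \<open>P\<close>.\<close>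

inductive under :: "(nat \<Rightarrow> nat) \<Rightarrow> nat \<Rightarrow> nat \<Rightarrow> bool" for P where
  parent: "reg (P k) = reg j \<Longrightarrow> P k \<le> j \<Longrightarrow> under P j k"
| step: "reg j < reg (P k) \<Longrightarrow> under P j (P k) \<Longrightarrow> under P j k"

context
  fixes P :: "nat \<Rightarrow> nat"
  assumes P: "parent_map P"
begin

lemma parent_mapD:
  assumes "1 \<le> k" "k \<le> n"
  shows "P k \<le> n" "reg (P k) < reg k" "P k < k"
  using P assms reg_less_imp[of "P k" k] by (auto simp: parent_map_def)

lemma parent_row:
  assumes "1 \<le> j" "j \<le> k" "k \<le> n" "reg (P k) < reg j"
  shows "row (P j) \<le> row (P k)"
  using P assms by (cases "j = k") (auto simp: parent_map_def)

lemma under_reg: "under P j k \<Longrightarrow> 1 \<le> k \<Longrightarrow> k \<le> n \<Longrightarrow> reg j < reg k"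
proof (induction rule: under.induct)
  case (parent k j)
  then show ?case using parent_mapD(2)[of k] by simp
next
  case (step j k)
  then show ?case using parent_mapD(2)[of k] by simp
qed

lemma under_mono: "under P i k \<Longrightarrow> reg i = reg j \<Longrightarrow> i \<le> j \<Longrightarrow> under P j k"
  by (induction rule: under.induct) (auto intro: under.intros)

text \<open>By \<open>parent_row\<close> the climb from \<open>x\<close> either arrives in the
  region of \<open>P c\<close>, weakly before \<open>P c\<close>, or reaches a smaller position with
  the same property as \<open>x\<close>.\<close>

lemma under_parent_below:
  assumes "1 \<le> x" "x \<le> c" "c \<le> n" "reg (P c) < reg x"
  shows "under P (P c) x"
  using assms
proof (induction x rule: less_induct)
  case (less x)
  note Px = parent_mapD[OF less.prems(1) order_trans[OF less.prems(2,3)]]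
  have "1 \<le> c" using less.prems by simp
  note Pc = parent_mapD[OF this less.prems(3)]
  have "row (P x) \<le> row (P c)" using parent_row less.prems by simp
  then consider "reg (P c) < reg (P x)" | "reg (P x) = reg (P c)" "P x \<le> P c"
    using row_le_iff Px Pc by auto
  then show ?case
  proof cases
    case 1
    have "1 \<le> P x" using reg_less_imp[OF 1 Pc(1)] by simp
    then have "under P (P c) (P x)" using less.IH[OF Px(3)] less.prems Px(3) 1 by simp
    then show ?thesis using 1 under.step by blast
  qed (auto intro: under.parent)
qed

text \<open>The climb from \<open>j\<close> meets the region of \<open>p\<close> at some
  \<open>z \<le> p\<close>, which need not be \<open>p\<close>. The relation with \<open>i\<close>
  passes from \<open>p\<close> to every such \<open>z\<close> by \<open>under_parent_below\<close>,
  with the induction on \<open>p\<close> where \<open>P p\<close> is not yet in the region of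
  \<open>i\<close>; from \<open>z\<close> it passes down to \<open>j\<close>.\<close>

lemma under_trans:
  assumes "under P i p" "under P p j" "1 \<le> i" "1 \<le> p" "p \<le> n" "1 \<le> j" "j \<le> n" "i \<le> n"
  shows "under P i j"
  using assms
proof (induction p arbitrary: i j rule: less_induct)
  case (less p)
  note Pp = parent_mapD[OF less.prems(4,5)]
  have rip: "reg i < reg p" using under_reg[OF less.prems(1,4,5)] .
  have below: "under P i z" if z: "1 \<le> z" "z \<le> p" "reg z = reg p" for z
    using less.prems(1)
  proof cases
    case parent
    have "under P (P p) z" using under_parent_below[of z p] z less.prems Pp by simp
    then show ?thesis using under_mono parent by simp
  next
    case step
    have "1 \<le> P p" using reg_less_imp[OF step(1)] less.prems(8) by simp
    moreover have "under P (P p) z" using under_parent_below[of z p] z less.prems Pp by simp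
    ultimately show ?thesis using less.IH[OF Pp(3) step(2)] z less.prems Pp by simp
  qed
  show ?case using less.prems(2,6,7)
  proof (induction p\<equiv>p j rule: under.induct)
    case (parent j)
    note Pj = parent_mapD[OF parent(3,4)]
    have "1 \<le> P j"
    proof (rule ccontr)
      assume "\<not> 1 \<le> P j"
      then have "P j = 0" by simp
      then show False using parent(1) reg_pos[of p] less.prems(4,5) by simp
    qed
    then have "under P i (P j)" using below parent by simp
    then show ?case using under.step rip parent(1) by simp
  next
    case (step j)
    note Pj = parent_mapD[OF step(4,5)]
    have "1 \<le> P j" using reg_less_imp[OF step(1)] less.prems(5) by simp
    then have "under P i (P j)" using step Pj by simp
    then show ?case using under.step rip step(1) by simp
  qed
qed

text \<open>Recovers the ancestor \<open>p\<close> behind \<open>under P j k\<close>. The climb from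
  \<open>k\<close> into any earlier region goes through \<open>p\<close>, which is what makes the
  reconstructed permutation avoid the pattern.\<close>

lemma under_ancestor:
  "under P j k \<Longrightarrow> \<exists>p. reg p = reg j \<and> p \<le> j \<and> under P p k \<and>
     (\<forall>i. under P i k \<longrightarrow> reg i < reg p \<longrightarrow> under P i p)"
proof (induction rule: under.induct)
  case (parent k j)
  have "under P i (P k)" if "under P i k" "reg i < reg (P k)" for i
    using that by cases auto
  then show ?case using parent under.parent[of P k "P k"] by blast
next
  case (step j k)
  then obtain p where p: "reg p = reg j" "p \<le> j" "under P p (P k)"
    "\<forall>i. under P i (P k) \<longrightarrow> reg i < reg p \<longrightarrow> under P i p" by blast
  have "under P i p" if "under P i k" "reg i < reg p" for i
    using that by cases (use p step in auto)
  then show ?case using p step under.step[of p P k] by auto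
qed

text \<open>Non-inversions are transitive too. When \<open>j\<close> is beyond the parent of
  \<open>k\<close>, it lies in the region of that parent, or in a later one, where
  \<open>under_parent_below\<close> applies.\<close>

lemma under_split:
  assumes "under P i k" "1 \<le> i" "i < j" "j < k" "k \<le> n"
  shows "under P i j \<or> under P j k"
  using assms
proof (induction rule: under.induct)
  case (parent k i)
  have ij: "reg i \<le> reg j" using reg_mono parent by simp
  show ?case
  proof (cases "reg i = reg j")
    case True
    then show ?thesis using parent under.parent[of P k j] by simp
  next
    case False
    then have "under P (P k) j" using under_parent_below[of j k] parent ij by simp
    then show ?thesis using under_mono parent by blast
  qed
next
  case (step i k)
  have k: "1 \<le> k" using step by simp
  note Pk = parent_mapD[OF k step.prems(4)]
  have Pk1: "1 \<le> P k" using reg_less_imp[OF step.hyps(1)] step.prems by simp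
  consider "j < P k" | "j = P k" | "P k < j" by linarith
  then show ?case
  proof cases
    case 1
    have "under P j k" if "under P j (P k)"
      using that under_reg[OF that Pk1 Pk(1)] under.step by blast
    then show ?thesis using step.IH step.prems 1 Pk by auto
  next
    case 2
    then show ?thesis using step by simp
  next
    case 3
    then have "reg (P k) \<le> reg j" using reg_mono step.prems by simp
    then consider "reg (P k) = reg j" | "reg (P k) < reg j" by linarith
    then show ?thesis
    proof cases
      case 1
      then show ?thesis using under.parent[of P k j] 3 by simp
    next
      case 2
      then have "under P (P k) j" using under_parent_below[of j k] step.prems by simp
      then show ?thesis using under_trans[OF step.hyps(2)] Pk1 Pk step.prems by auto
    qed
  qed
qed

text \<open>The order of the positions by increasing value in the permutation to be built.\<close>

definition before :: "nat \<Rightarrow> nat \<Rightarrow> bool" where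
  "before x y \<longleftrightarrow> (x < y \<and> \<not> under P x y) \<or> (y < x \<and> under P y x)"

lemma before_trans:
  assumes "before x y" "before y z" and "x \<in> {1..n}" "y \<in> {1..n}" "z \<in> {1..n}"
  shows "before x z"
proof -
  have *: "\<not> under P i k" if "i < j" "j < k" "\<not> under P i j" "\<not> under P j k" "1 \<le> i" "k \<le> n" for i j k
    using under_split that by blast
  have **: "under P i k" if "under P i j" "under P j k" "1 \<le> i" "i < j" "j < k" "k \<le> n" for i j k
    using under_trans[of i j k] that by simp
  have "x \<noteq> z" using assms(1,2) by (auto simp: before_def)
  then consider "x < y" "y < z" | "x < z" "z < y" | "y < x" "x < z" | "y < z" "z < x" | "z < x" "x < y"
    | "z < y" "y < x"
    using assms(1,2) unfolding before_def by (metis linorder_neqE_nat)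
  then show ?thesis
  proof cases
    case 1 then show ?thesis using assms *[of x y z] by (auto simp: before_def)
  next
    case 2 then show ?thesis using assms **[of x z y] by (auto simp: before_def)
  next
    case 3 then show ?thesis using assms **[of y x z] by (auto simp: before_def)
  next
    case 4 then show ?thesis using assms *[of y z x] by (auto simp: before_def)
  next
    case 5 then show ?thesis using assms *[of z x y] by (auto simp: before_def)
  next
    case 6 then show ?thesis using assms **[of z y x] by (auto simp: before_def)
  qed
qed

definition rank :: "nat \<Rightarrow> nat" where
  "rank x = (if x \<in> {1..n} then card {y \<in> {1..n}. y = x \<or> before y x} else x)"

lemma rank_less:
  assumes "x \<in> {1..n}" "y \<in> {1..n}" "before x y"
  shows "rank x < rank y"
proof -
  have "y \<notin> {z \<in> {1..n}. z = x \<or> before z x}" using assms(3) by (auto simp: before_def)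
  moreover have "y \<in> {z \<in> {1..n}. z = y \<or> before z y}" using assms(2) by simp
  moreover have "{z \<in> {1..n}. z = x \<or> before z x} \<subseteq> {z \<in> {1..n}. z = y \<or> before z y}"
    using before_trans[OF _ assms(3)] assms by auto
  ultimately have "{z \<in> {1..n}. z = x \<or> before z x} \<subset> {z \<in> {1..n}. z = y \<or> before z y}"
    by blast
  then have "card {z \<in> {1..n}. z = x \<or> before z x} < card {z \<in> {1..n}. z = y \<or> before z y}"
    by (intro psubset_card_mono) auto
  then show ?thesis using assms by (simp add: rank_def)
qed

lemma rank_less_iff:
  assumes "x \<in> {1..n}" "y \<in> {1..n}"
  shows "rank x < rank y \<longleftrightarrow> before x y"
proof -
  have "before x y \<or> before y x \<or> x = y" by (auto simp: before_def)
  then show ?thesis using rank_less assms by (metis less_asym less_irrefl)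
qed

lemma rank_permutes: "rank permutes {1..n}"
proof (rule bij_imp_permutes)
  have inj: "inj_on rank {1..n}"
  proof (rule inj_onI)
    fix x y assume "x \<in> {1..n}" "y \<in> {1..n}" "rank x = rank y"
    then show "x = y" using rank_less[of x y] rank_less[of y x] unfolding before_def
      by (metis less_irrefl linorder_neqE_nat)
  qed
  have "rank ` {1..n} \<subseteq> {1..n}"
  proof
    fix r assume "r \<in> rank ` {1..n}"
    then obtain x where x: "x \<in> {1..n}" "r = card {y \<in> {1..n}. y = x \<or> before y x}"
      by (auto simp: rank_def)
    have "{x} \<subseteq> {y \<in> {1..n}. y = x \<or> before y x}" using x by auto
    then have "card {x} \<le> r" unfolding x(2) by (intro card_mono) auto
    moreover have "r \<le> card {1..n}" unfolding x(2) by (intro card_mono) auto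
    ultimately show "r \<in> {1..n}" by simp
  qed
  then show "bij_betw rank {1..n} {1..n}"
    using inj by (simp add: bij_betw_def endo_inj_surj)
qed (auto simp: rank_def)

lemma inversion_iff:
  assumes "1 \<le> i" "i < j" "j \<le> n"
  shows "rank j < rank i \<longleftrightarrow> under P i j"
  using rank_less_iff[of j i] assms by (auto simp: before_def)

text \<open>In a pattern \<open>i < j < k\<close> the inversion of \<open>j\<close> with
  \<open>k\<close> comes from an ancestor \<open>p\<close> of \<open>k\<close> in the region of
  \<open>j\<close>. As \<open>i\<close> is inverted with \<open>k\<close> and in an earlier region,
  it is inverted with \<open>p\<close>. So the value of \<open>p\<close> lies strictly between those
  of \<open>k\<close> and \<open>i\<close>, which cannot be consecutive.\<close>

lemma avoiding_rank: "avoiding rank"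
  unfolding avoiding_def
proof (intro conjI allI impI notI)
  show "rank permutes {1..n}" by (rule rank_permutes)
next
  fix i j assume ij: "1 \<le> i" "i < j" "j \<le> n" "reg i = reg j"
  then have "\<not> under P i j" using under_reg[of i j] by auto
  then show "rank i < rank j" using rank_less_iff[of i j] ij by (simp add: before_def)
next
  assume "\<exists>i j k. 1 \<le> i \<and> i < j \<and> j < k \<and> k \<le> n \<and> reg i \<noteq> reg j \<and> reg j \<noteq> reg k \<and>
          reg i \<noteq> reg k \<and> rank i < rank j \<and> rank i = rank k + 1"
  then obtain i j k where ijk: "1 \<le> i" "i < j" "j < k" "k \<le> n" and reg: "reg i \<noteq> reg j"
    and r: "rank i < rank j" "rank i = rank k + 1" by blast
  have ik: "under P i k" and jk: "under P j k" and nij: "\<not> under P i j"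
    using inversion_iff[of i k] inversion_iff[of j k] inversion_iff[of i j] ijk r by auto
  obtain p where p: "reg p = reg j" "p \<le> j" "under P p k"
    and ip': "under P i k \<Longrightarrow> reg i < reg p \<Longrightarrow> under P i p"
    using under_ancestor[OF jk] by blast
  have rij: "reg i < reg p" using reg_mono[of i j] ijk reg p(1) by simp
  have ip: "i < p" using reg_less_imp rij ijk by simp
  have "rank p < rank i" using inversion_iff[of i p] ip ip' ik rij p ijk by simp
  moreover have "rank k < rank p" using inversion_iff[of p k] p ijk ip by simp
  ultimately show False using r by simp
qed

text \<open>\<open>P k\<close> is inverted with \<open>k\<close>, so by \<open>row_par_le\<close>
  the parent in \<open>rank\<close> is no higher. Conversely that parent is related to
  \<open>k\<close> by \<open>under\<close>, and nothing so related is lower than \<open>P k\<close>,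
  where the climb begins.\<close>

lemma par_rank:
  assumes k: "1 \<le> k" "k \<le> n"
  shows "par rank k = P k"
proof -
  note Pk = parent_mapD[OF k]
  note perm = rank_permutes
  have lt: "ext rank k < ext rank (P k)"
  proof (cases "P k = 0")
    case True
    then show ?thesis using ext_in[OF perm k] by (simp add: ext_def)
  next
    case False
    have "under P (P k) k" by (rule under.parent) auto
    then have "rank k < rank (P k)" using inversion_iff[of "P k" k] False Pk k by simp
    then show ?thesis using ext_in[OF perm k] ext_in[OF perm, of "P k"] False Pk by simp
  qed
  have "row (P k) \<le> row (par rank k)"
  proof (cases "par rank k = 0")
    case True
    have "reg 0 < reg (P k) \<or> P k = 0" using reg_pos[of "P k"] Pk by auto
    then show ?thesis using True row_le_iff[of "P k" 0] Pk by auto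
  next
    case False
    note p = par[OF perm k]
    have "rank k < rank (par rank k)"
      using p ext_in[OF perm k] ext_in[OF perm, of "par rank k"] False k by simp
    then have u: "under P (par rank k) k" using inversion_iff[of "par rank k" k] False p(1) k by simp
    show ?thesis using u
    proof cases
      case parent
      then show ?thesis using row_le_iff Pk p(1) k by simp
    next
      case step
      then show ?thesis using row_le_iff[of "P k" "par rank k"] Pk p(1) k by simp
    qed
  qed
  moreover have "row (par rank k) \<le> row (P k)"
    using row_par_le[OF avoiding_rank k Pk(3) lt] .
  moreover have "P k \<le> n" "par rank k \<le> n" using Pk par(1)[OF perm k] k by simp_all
  ultimately show ?thesis by (auto simp: row_le_iff)
qed

end

lemma ex_avoiding_par:
  assumes "parent_map P"
  shows "\<exists>w. avoiding w \<and> (\<forall>k. 1 \<le> k \<longrightarrow> k \<le> n \<longrightarrow> par w k = P k)"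
  using avoiding_rank[OF assms] par_rank[OF assms] by blast

lemma parent_map_par:
  assumes "avoiding w"
  shows "parent_map (par w)"
  unfolding parent_map_def
proof (intro conjI allI impI)
  fix k assume k: "1 \<le> k" "k \<le> n"
  show "par w k \<le> n" using par(1)[OF avoiding_permutes[OF assms] k] k by simp
  show "reg (par w k) < reg k" using reg_par_less[OF assms k] .
qed (use row_par_mono[OF assms] in simp)

end

section \<open>Counting children\<close>

definition degrees :: "ltree list \<Rightarrow> (nat \<times> nat) list" where
  "degrees ts = map (\<lambda>v. (label v, length (children v))) (concat (map nodes ts))"

abbreviation labels :: "ltree list \<Rightarrow> nat set" where
  "labels ts \<equiv> fst ` set (degrees ts)"

lemma degrees_simps [simp]:
  "degrees [] = []"
  "degrees (Node l cs # ts) = (l, length cs) # degrees cs @ degrees ts"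
  by (simp_all add: degrees_def)

fun search_forest :: "ltree list \<Rightarrow> bool" where
  "search_forest [] \<longleftrightarrow> True"
| "search_forest (Node l cs # ts) \<longleftrightarrow>
     (\<forall>x \<in> labels cs. x < l) \<and> (\<forall>x \<in> labels ts. l < x) \<and> search_forest cs \<and> search_forest ts"

lemma labels_insert_walk: "labels (insert_walk x ts) = insert x (labels ts)"
  by (induction x ts rule: insert_walk.induct) auto

lemma search_forest_insert_walk:
  "search_forest ts \<Longrightarrow> x \<notin> labels ts \<Longrightarrow> search_forest (insert_walk x ts)"
  by (induction x ts rule: insert_walk.induct) (auto simp: labels_insert_walk)

text \<open>Descendants are smaller than their root, so some label exceeds \<open>x\<close> exactly
  when some root does; then the walk descends there instead of adding a root.\<close>

lemma length_insert_walk: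
  "search_forest ts \<Longrightarrow> x \<notin> labels ts \<Longrightarrow>
     length (insert_walk x ts) = length ts + (if \<exists>z \<in> labels ts. x < z then 0 else 1)"
  by (induction x ts rule: insert_walk.induct) (auto simp: image_Un)

lemma map_of_degrees_eq_None: "map_of (degrees ts) l = None \<longleftrightarrow> l \<notin> labels ts"
  by (simp add: map_of_eq_None_iff)

text \<open>The walk descends at the first root exceeding \<open>x\<close>. Everything to its left
  is smaller than \<open>x\<close> and everything to its right larger than this root, so the least
  label exceeding \<open>x\<close> is in this tree: the root itself if none of its descendants
  exceeds \<open>x\<close>.\<close>

lemma degrees_insert_walk:
  assumes "search_forest ts" "x \<notin> labels ts"
  shows "map_of (degrees (insert_walk x ts)) l =
    (if l = x then Some 0
     else map_option (\<lambda>c. if x < l \<and> (\<forall>z \<in> labels ts. x < z \<longrightarrow> l \<le> z) then Suc c else c)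
       (map_of (degrees ts) l))"
  using assms
proof (induction x ts rule: insert_walk.induct)
  case (2 x l0 cs ts)
  have cs: "\<And>z. z \<in> labels cs \<Longrightarrow> z < l0" and ts: "\<And>z. z \<in> labels ts \<Longrightarrow> l0 < z"
    and sf: "search_forest cs" "search_forest ts"
    using 2(3) by auto
  have x: "x \<noteq> l0" "x \<notin> labels cs" "x \<notin> labels ts" using 2(4) by auto
  have none: "z \<notin> labels f \<Longrightarrow> map_of (degrees f) z = None" for z f
    by (simp add: map_of_degrees_eq_None)
  consider "l = l0" | "l = x" | "l \<in> labels cs" "l \<noteq> x" "l < l0" | "l \<in> labels ts" "l \<noteq> x" "l0 < l"
    | "l \<noteq> l0" "l \<noteq> x" "l \<notin> labels cs" "l \<notin> labels ts"
    using cs ts x by blast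
  note split = this
  show ?case
  proof (cases "x < l0")
    case True
    have IH: "map_of (degrees (insert_walk x cs)) l =
      (if l = x then Some 0
       else map_option (\<lambda>c. if x < l \<and> (\<forall>z \<in> labels cs. x < z \<longrightarrow> l \<le> z) then Suc c else c)
         (map_of (degrees cs) l))"
      using 2(1)[OF True sf(1) x(2)] .
    show ?thesis
    proof (cases rule: split)
      case 1
      have "(\<forall>z \<in> labels (Node l0 cs # ts). x < z \<longrightarrow> l0 \<le> z) \<longleftrightarrow> \<not> (\<exists>z \<in> labels cs. x < z)"
        using cs ts by force
      then show ?thesis using 1 True x length_insert_walk[OF sf(1) x(2)] by auto
    next
      case 2
      then show ?thesis using IH True x by (simp add: map_add_def none)
    next
      case 3
      have "(\<forall>z \<in> labels (Node l0 cs # ts). x < z \<longrightarrow> l \<le> z) \<longleftrightarrow> (\<forall>z \<in> labels cs. x < z \<longrightarrow> l \<le> z)"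
        using 3 ts by force
      moreover have "l \<notin> labels ts" using 3 ts by force
      ultimately show ?thesis using IH True x 3 by (simp add: map_add_def none split: option.split)
    next
      case 4
      have "\<not> (\<forall>z \<in> labels (Node l0 cs # ts). x < z \<longrightarrow> l \<le> z)" using 4 True by auto
      moreover have "l \<notin> labels cs" using 4 cs by force
      ultimately show ?thesis using True x 4 IH by (auto simp add: map_add_def none option.map_ident split: option.split)
    next
      case 5
      then show ?thesis using True IH by (simp add: map_add_def none)
    qed
  next
    case False
    have IH: "map_of (degrees (insert_walk x ts)) l =
      (if l = x then Some 0
       else map_option (\<lambda>c. if x < l \<and> (\<forall>z \<in> labels ts. x < z \<longrightarrow> l \<le> z) then Suc c else c)
         (map_of (degrees ts) l))"
      using 2(2)[OF False sf(2) x(3)] .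
    have lt: "l0 < x" using False x by simp
    show ?thesis
    proof (cases rule: split)
      case 1
      then show ?thesis using lt by auto
    next
      case 2
      then show ?thesis using IH lt x by (simp add: map_add_def none)
    next
      case 3
      then show ?thesis using IH lt ts[of l] by (auto simp: map_add_def none option.map_ident split: option.split)
    next
      case 4
      have "(\<forall>z \<in> labels (Node l0 cs # ts). x < z \<longrightarrow> l \<le> z) \<longleftrightarrow> (\<forall>z \<in> labels ts. x < z \<longrightarrow> l \<le> z)"
        using lt cs by force
      moreover have "l \<notin> labels cs" using 4 cs by force
      ultimately show ?thesis using IH lt 4 by (simp add: map_add_def none split: option.split)
    next
      case 5
      then show ?thesis using lt IH by (simp add: map_add_def none)
    qed
  qed
qed auto

lemma map_of_map_find:
  "map_of (map (\<lambda>v. (f v, g v)) vs) l = map_option g (find (\<lambda>v. f v = l) vs)"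
  by (induction vs) auto

lemma num_children_eq:
  "map_of (degrees [T]) l = Some c \<Longrightarrow> num_children T l = c"
  by (auto simp: degrees_def num_children_def map_of_map_find)

section \<open>Numbers of children as sizes of fibres of the parent map\<close>

context regions
begin

lemma fold_insert_walk:
  assumes perm: "w permutes {1..n}" and "i \<le> n"
  shows "\<exists>cs. fold insert_walk (map w [1..<Suc i]) [Node (n + 1) []] = [Node (n + 1) cs] \<and>
    search_forest [Node (n + 1) cs] \<and> labels [Node (n + 1) cs] = ext w ` {0..i} \<and>
    (\<forall>p \<le> i. map_of (degrees [Node (n + 1) cs]) (ext w p) = Some (card {k. 1 \<le> k \<and> k \<le> i \<and> par w k = p}))"
  using assms(2)
proof (induction i)
  case 0
  then show ?case by (simp add: ext_def)
next
  case (Suc i)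
  then obtain cs where cs: "fold insert_walk (map w [1..<Suc i]) [Node (n + 1) []] = [Node (n + 1) cs]"
    and sf: "search_forest [Node (n + 1) cs]" and lab: "labels [Node (n + 1) cs] = ext w ` {0..i}"
    and deg: "\<And>p. p \<le> i \<Longrightarrow> map_of (degrees [Node (n + 1) cs]) (ext w p) =
      Some (card {k. 1 \<le> k \<and> k \<le> i \<and> par w k = p})"
    by auto
  let ?x = "w (Suc i)"
  have x: "?x < n + 1" "ext w (Suc i) = ?x" using ext_in[OF perm, of "Suc i"] Suc.prems by auto
  have notin: "?x \<notin> labels [Node (n + 1) cs]"
  proof
    assume "?x \<in> labels [Node (n + 1) cs]"
    then have "ext w (Suc i) \<in> ext w ` {0..i}" unfolding lab x(2) .
    then obtain j where "j \<le> i" "ext w (Suc i) = ext w j" by auto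
    then show False using ext_inj[OF perm, of "Suc i" j] Suc.prems by simp
  qed
  let ?cs = "insert_walk ?x cs"
  have new: "insert_walk ?x [Node (n + 1) cs] = [Node (n + 1) ?cs]" using x by simp
  have "map_of (degrees [Node (n + 1) ?cs]) (ext w p) =
      Some (card {k. 1 \<le> k \<and> k \<le> Suc i \<and> par w k = p})" if p: "p \<le> Suc i" for p
  proof (cases "p = Suc i")
    case True
    have "par w k \<noteq> Suc i" if "1 \<le> k" "k \<le> Suc i" for k
      using par(1)[OF perm, of k] that Suc.prems by simp
    then have "{k. 1 \<le> k \<and> k \<le> Suc i \<and> par w k = p} = {}" using True by auto
    moreover have "map_of (degrees [Node (n + 1) ?cs]) (ext w p) = Some 0"
      using degrees_insert_walk[OF sf notin, of "ext w p"] True x unfolding new by simp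
    ultimately show ?thesis by simp
  next
    case False
    then have pi: "p \<le> i" using p by simp
    have ne: "ext w p \<noteq> ?x" using ext_inj[OF perm, of p "Suc i"] x False p Suc.prems by auto
    \<comment> \<open>The labels present are the letters at positions \<open>0\<close> to
      \<open>i\<close>, so the minimality in \<open>degrees_insert_walk\<close> is that in
      \<open>par\<close>.\<close>
    have iff: "(?x < ext w p \<and> (\<forall>z \<in> labels [Node (n + 1) cs]. ?x < z \<longrightarrow> ext w p \<le> z)) \<longleftrightarrow>
        par w (Suc i) = p"
    proof
      assume a: "?x < ext w p \<and> (\<forall>z \<in> labels [Node (n + 1) cs]. ?x < z \<longrightarrow> ext w p \<le> z)"
      have "ext w p \<le> ext w j" if "j < Suc i" "ext w (Suc i) < ext w j" for j
      proof -
        have "ext w j \<in> labels [Node (n + 1) cs]" unfolding lab using that by simp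
        then show ?thesis using a that(2) unfolding x(2) by blast
      qed
      then show "par w (Suc i) = p" using par_eqI[OF perm, of "Suc i" p] Suc.prems pi a x by simp
    next
      assume "par w (Suc i) = p"
      then show "?x < ext w p \<and> (\<forall>z \<in> labels [Node (n + 1) cs]. ?x < z \<longrightarrow> ext w p \<le> z)"
        unfolding lab using par[OF perm, of "Suc i"] Suc.prems x by auto
    qed
    have step: "{k. 1 \<le> k \<and> k \<le> Suc i \<and> par w k = p} =
        (if par w (Suc i) = p then insert (Suc i) else id) {k. 1 \<le> k \<and> k \<le> i \<and> par w k = p}"
      by (auto simp: le_Suc_eq)
    have "finite {k. 1 \<le> k \<and> k \<le> i \<and> par w k = p}" by simp
    then have "card {k. 1 \<le> k \<and> k \<le> Suc i \<and> par w k = p} =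
        (if par w (Suc i) = p then Suc else id) (card {k. 1 \<le> k \<and> k \<le> i \<and> par w k = p})"
      unfolding step by simp
    then show ?thesis
      using degrees_insert_walk[OF sf notin, of "ext w p"] ne deg[OF pi] unfolding new iff by simp
  qed
  moreover have "labels [Node (n + 1) ?cs] = ext w ` {0..Suc i}"
    using labels_insert_walk[of ?x "[Node (n + 1) cs]"] lab x
    unfolding new by (simp add: atLeast0_atMost_Suc)
  moreover have "search_forest [Node (n + 1) ?cs]"
    using search_forest_insert_walk[OF sf notin] unfolding new .
  moreover have "fold insert_walk (map w [1..<Suc (Suc i)]) [Node (n + 1) []] = [Node (n + 1) ?cs]"
    using cs new by simp
  ultimately show ?case by blast
qed

lemma num_children_tree_of:
  assumes perm: "w permutes {1..n}"
  shows "length (children (tree_of n w)) = card {k. 1 \<le> k \<and> k \<le> n \<and> par w k = 0}"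
    and "1 \<le> p \<Longrightarrow> p \<le> n \<Longrightarrow>
      num_children (tree_of n w) (w p) = card {k. 1 \<le> k \<and> k \<le> n \<and> par w k = p}"
proof -
  obtain cs where cs: "fold insert_walk (map w [1..<Suc n]) [Node (n + 1) []] = [Node (n + 1) cs]"
    and deg: "\<And>p. p \<le> n \<Longrightarrow> map_of (degrees [Node (n + 1) cs]) (ext w p) =
      Some (card {k. 1 \<le> k \<and> k \<le> n \<and> par w k = p})"
    using fold_insert_walk[OF perm order_refl] by blast
  have T: "tree_of n w = Node (n + 1) cs" unfolding tree_of_def using cs by simp
  show "length (children (tree_of n w)) = card {k. 1 \<le> k \<and> k \<le> n \<and> par w k = 0}"
    using deg[of 0] unfolding T by (simp add: ext_def)
  show "num_children (tree_of n w) (w p) = card {k. 1 \<le> k \<and> k \<le> n \<and> par w k = p}"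
    if "1 \<le> p" "p \<le> n"
    using num_children_eq[OF deg[OF that(2)]] ext_in[OF perm that] unfolding T by simp
qed

end

section \<open>Compositions\<close>

lemma psum_0 [simp]: "psum \<alpha> 0 = 0"
  by (simp add: psum_def)

lemma psum_length: "length \<alpha> \<le> a \<Longrightarrow> psum \<alpha> a = sum_list \<alpha>"
  by (simp add: psum_def)

lemma psum_Suc_Cons [simp]: "psum (a # \<alpha>) (Suc b) = a + psum \<alpha> b"
  by (simp add: psum_def)

lemma psum_mono: "a \<le> b \<Longrightarrow> psum \<alpha> a \<le> psum \<alpha> b"
  by (auto simp: psum_def le_iff_add take_add)

lemma psum_le: "psum \<alpha> a \<le> sum_list \<alpha>"
  by (metis nle_le psum_length psum_mono)

lemma psum_rev: "b \<le> length \<alpha> \<Longrightarrow> psum (rev \<alpha>) b = sum_list \<alpha> - psum \<alpha> (length \<alpha> - b)"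
  by (metis add_diff_cancel_left' append_take_drop_id psum_def rev_take sum_list_append sum_list_rev take_rev)

lemma Flip_nu_of: "Flip (nu_of \<alpha>) = nu_of (rev \<alpha>)"
  by (simp add: Flip_def nu_of_def rev_concat map_concat rev_map comp_def)

lemma count_list_replicate: "count_list (replicate k x) y = (if x = y then k else 0)"
  by (induction k) auto

lemma endpoint_nu_of: "endpoint (nu_of \<alpha>) = (sum_list \<alpha>, sum_list \<alpha>)"
  by (induction \<alpha>) (auto simp: nu_of_def endpoint_def count_list_replicate)

lemma reach_replicate_N: "reach (replicate a N @ \<mu>) y = (if y < a then 0 else reach \<mu> (y - a))"
proof -
  have "reach (replicate a N) y = 0" for y by (metis count_list_replicate le_0_eq reach_le step.distinct(1))
  then show ?thesis by (simp add: reach_append count_list_replicate)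
qed

lemma reach_replicate_E: "reach (replicate a E @ \<mu>) y = a + reach \<mu> y"
  by (induction a) auto

text \<open>The north step leaving height \<open>y\<close> belongs to block \<open>b\<close>,
  counted from \<open>0\<close>, or there is none if \<open>b = length \<beta>\<close>. By then the
  east steps of exactly the first \<open>b\<close> blocks have been taken.\<close>

lemma reach_nu_of:
  assumes "b \<le> length \<beta>" "psum \<beta> b \<le> y" "b < length \<beta> \<Longrightarrow> y < psum \<beta> (Suc b)"
  shows "reach (nu_of \<beta>) y = psum \<beta> b"
  using assms
proof (induction \<beta> arbitrary: b y)
  case Nil
  then show ?case by (simp add: nu_of_def)
next
  case (Cons a \<beta>)
  have nu: "nu_of (a # \<beta>) = replicate a N @ replicate a E @ nu_of \<beta>" by (simp add: nu_of_def)
  show ?case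
  proof (cases b)
    case 0
    then show ?thesis using Cons.prems unfolding nu by (simp add: reach_replicate_N)
  next
    case (Suc b')
    then have "reach (nu_of \<beta>) (y - a) = psum \<beta> b'" using Cons.prems by (intro Cons.IH) auto
    then show ?thesis using Suc Cons.prems unfolding nu
      by (simp add: reach_replicate_N reach_replicate_E)
  qed
qed

text \<open>A form of \<open>region_index\<close> that also puts the root position \<open>0\<close>
  in a region of its own and is adjoint to \<open>psum\<close>
  (\<open>region_of_le_iff\<close>).\<close>

definition region_of :: "nat list \<Rightarrow> nat \<Rightarrow> nat" where
  "region_of \<alpha> i = (LEAST a. i \<le> psum \<alpha> a)"

text \<open>The row of \<open>Flip (Theta \<alpha> w)\<close> whose east steps stem from the children of position \<open>p\<close>;
  truncated subtraction gives the top row for the root \<open>p = 0\<close>.\<close>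

definition row_of :: "nat list \<Rightarrow> nat \<Rightarrow> nat" where
  "row_of \<alpha> p = (sum_list \<alpha> - psum \<alpha> (region_of \<alpha> p)) + (p - psum \<alpha> (region_of \<alpha> p - 1) - 1)"

lemma region_of_le_iff:
  assumes "i \<le> sum_list \<alpha>"
  shows "region_of \<alpha> i \<le> a \<longleftrightarrow> i \<le> psum \<alpha> a"
proof -
  have "i \<le> psum \<alpha> (length \<alpha>)" using assms by (simp add: psum_length)
  then have "i \<le> psum \<alpha> (region_of \<alpha> i)" unfolding region_of_def by (rule LeastI)
  then show ?thesis using psum_mono[of "region_of \<alpha> i" a \<alpha>] Least_le[of "\<lambda>a. i \<le> psum \<alpha> a" a]
    unfolding region_of_def by linarith
qed

lemma region_of_bounds:
  assumes "1 \<le> i" "i \<le> sum_list \<alpha>"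
  shows "1 \<le> region_of \<alpha> i" "region_of \<alpha> i \<le> length \<alpha>"
    "psum \<alpha> (region_of \<alpha> i - 1) < i" "i \<le> psum \<alpha> (region_of \<alpha> i)"
proof -
  show *: "1 \<le> region_of \<alpha> i" using region_of_le_iff[OF assms(2), of 0] assms(1) by simp
  show "region_of \<alpha> i \<le> length \<alpha>" "i \<le> psum \<alpha> (region_of \<alpha> i)"
    using region_of_le_iff[OF assms(2), of "length \<alpha>"] assms(2)
      region_of_le_iff[OF assms(2), of "region_of \<alpha> i"] by (simp_all add: psum_length)
  show "psum \<alpha> (region_of \<alpha> i - 1) < i"
    using region_of_le_iff[OF assms(2), of "region_of \<alpha> i - 1"] * by linarith
qed

lemma region_of_0 [simp]: "region_of \<alpha> 0 = 0"
  by (simp add: region_of_def)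

lemma region_of_eqI:
  assumes "psum \<alpha> (a - 1) < i" "i \<le> psum \<alpha> a"
  shows "region_of \<alpha> i = a"
proof -
  have "i \<le> sum_list \<alpha>" using assms(2) psum_le order_trans by blast
  then have "region_of \<alpha> i \<le> a" "\<not> region_of \<alpha> i \<le> a - 1"
    using assms region_of_le_iff by auto
  then show ?thesis by simp
qed

lemma region_index_eq:
  assumes "1 \<le> i" "i \<le> sum_list \<alpha>"
  shows "region_index \<alpha> i = region_of \<alpha> i"
  unfolding region_index_def
proof (rule the_equality)
  show "region_of \<alpha> i \<in> {1..length \<alpha>} \<and> i \<in> region \<alpha> (region_of \<alpha> i)"
    using region_of_bounds[OF assms] by (simp add: region_def Suc_le_eq)
  show "a = region_of \<alpha> i" if "a \<in> {1..length \<alpha>} \<and> i \<in> region \<alpha> a" for a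
    using that region_of_eqI[of \<alpha> a i] by (simp add: region_def Suc_le_eq)
qed

lemma row_of_0 [simp]: "row_of \<alpha> 0 = sum_list \<alpha>"
  by (simp add: row_of_def)

lemma row_of_bounds:
  assumes "1 \<le> p" "p \<le> sum_list \<alpha>"
  shows "sum_list \<alpha> - psum \<alpha> (region_of \<alpha> p) \<le> row_of \<alpha> p"
    "row_of \<alpha> p < sum_list \<alpha> - psum \<alpha> (region_of \<alpha> p - 1)"
  using region_of_bounds[OF assms] psum_le[of \<alpha> "region_of \<alpha> p"] by (auto simp: row_of_def)

lemma row_of_less:
  assumes "p \<le> sum_list \<alpha>" "q \<le> sum_list \<alpha>" "region_of \<alpha> q < region_of \<alpha> p"
  shows "row_of \<alpha> p < row_of \<alpha> q"
proof -
  have p: "1 \<le> p" using assms(3) by (cases p) auto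
  have "psum \<alpha> (region_of \<alpha> q) \<le> psum \<alpha> (region_of \<alpha> p - 1)"
    using assms(3) by (intro psum_mono) simp
  moreover have "sum_list \<alpha> - psum \<alpha> (region_of \<alpha> q) \<le> row_of \<alpha> q" by (simp add: row_of_def)
  ultimately show ?thesis using row_of_bounds(2)[OF p assms(1)] by linarith
qed

lemma row_of_le_iff:
  assumes "p \<le> sum_list \<alpha>" "q \<le> sum_list \<alpha>"
  shows "row_of \<alpha> p \<le> row_of \<alpha> q \<longleftrightarrow>
    region_of \<alpha> q < region_of \<alpha> p \<or> (region_of \<alpha> p = region_of \<alpha> q \<and> p \<le> q)"
proof -
  consider "region_of \<alpha> p < region_of \<alpha> q" | "region_of \<alpha> q < region_of \<alpha> p"
    | "region_of \<alpha> p = region_of \<alpha> q" by linarith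
  then show ?thesis
  proof cases
    case 1
    then show ?thesis using row_of_less assms by force
  next
    case 2
    then show ?thesis using row_of_less[of p \<alpha> q] assms by simp
  next
    case 3
    show ?thesis
    proof (cases "p = 0 \<or> q = 0")
      case True
      then have "region_of \<alpha> p = 0" "region_of \<alpha> q = 0" using 3 by auto
      then have "p = 0" "q = 0" using region_of_le_iff[of _ \<alpha> 0] assms by auto
      then show ?thesis by simp
    next
      case False
      then have "psum \<alpha> (region_of \<alpha> q - 1) < p" "psum \<alpha> (region_of \<alpha> q - 1) < q"
        using region_of_bounds(3)[of p \<alpha>] region_of_bounds(3)[of q \<alpha>] assms 3 by auto
      then show ?thesis using 3 by (auto simp: row_of_def)
    qed
  qed
qed

lemma regions_composition: "regions (sum_list \<alpha>) (region_of \<alpha>) (row_of \<alpha>)"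
proof
  show "region_of \<alpha> i \<le> region_of \<alpha> j" if "i \<le> j" "j \<le> sum_list \<alpha>" for i j
    using that region_of_le_iff[of i \<alpha>] region_of_le_iff[of j \<alpha>] by (meson order_refl order_trans)
  show "region_of \<alpha> 0 < region_of \<alpha> i" if "0 < i" "i \<le> sum_list \<alpha>" for i
    using region_of_bounds(1)[of i \<alpha>] that by simp
qed (rule row_of_le_iff)

interpretation regions "sum_list \<alpha>" "region_of \<alpha>" "row_of \<alpha>" for \<alpha>
  by (rule regions_composition)

lemma row_of_bij: "bij_betw (row_of \<alpha>) {0..sum_list \<alpha>} {0..sum_list \<alpha>}"
proof -
  have "inj_on (row_of \<alpha>) {0..sum_list \<alpha>}"
  proof (rule inj_onI)
    fix p q assume "p \<in> {0..sum_list \<alpha>}" "q \<in> {0..sum_list \<alpha>}" "row_of \<alpha> p = row_of \<alpha> q"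
    then show "p = q" using row_of_le_iff[of p \<alpha> q] row_of_le_iff[of q \<alpha> p] by auto
  qed
  moreover have "row_of \<alpha> p \<le> sum_list \<alpha>" if "p \<le> sum_list \<alpha>" for p
    using row_of_bounds(2)[of p \<alpha>] that by (cases p) auto
  ultimately show ?thesis by (simp add: bij_betw_def endo_inj_surj image_subset_iff)
qed

section \<open>Bracket vectors of the flipped path as parent maps\<close>

lemma reach_row_of:
  assumes "p \<le> sum_list \<alpha>"
  shows "reach (Flip (nu_of \<alpha>)) (row_of \<alpha> p) = sum_list \<alpha> - psum \<alpha> (region_of \<alpha> p)"
proof -
  have le: "region_of \<alpha> p \<le> length \<alpha>"
    using assms by (simp add: region_of_le_iff psum_length)
  define b where "b = length \<alpha> - region_of \<alpha> p"
  have b: "b \<le> length \<alpha>" "psum (rev \<alpha>) b = sum_list \<alpha> - psum \<alpha> (region_of \<alpha> p)"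
    using le psum_rev[of b \<alpha>] by (simp_all add: b_def)
  have "reach (nu_of (rev \<alpha>)) (row_of \<alpha> p) = psum (rev \<alpha>) b"
  proof (rule reach_nu_of)
    show "psum (rev \<alpha>) b \<le> row_of \<alpha> p" unfolding b(2) by (simp add: row_of_def)
    assume "b < length (rev \<alpha>)"
    then have "1 \<le> region_of \<alpha> p" and Suc: "Suc b \<le> length \<alpha>" "length \<alpha> - Suc b = region_of \<alpha> p - 1"
      using le by (auto simp: b_def)
    then have "1 \<le> p" by (cases p) auto
    then show "row_of \<alpha> p < psum (rev \<alpha>) (Suc b)"
      using row_of_bounds(2)[of p \<alpha>] assms psum_rev[OF Suc(1)] Suc(2) by simp
  qed (use b in simp)
  then show ?thesis using b by (simp add: Flip_nu_of)
qed

text \<open>By \<open>reach_row_of\<close>, the items pushed by the row of \<open>p\<close> are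
  those of the positions beyond the end of its region.\<close>

lemma less_reach_row_of_iff:
  assumes "1 \<le> k" "k \<le> sum_list \<alpha>" "p \<le> sum_list \<alpha>"
  shows "sum_list \<alpha> - k < reach (Flip (nu_of \<alpha>)) (row_of \<alpha> p) \<longleftrightarrow> region_of \<alpha> p < region_of \<alpha> k"
  using region_of_le_iff[OF assms(2), of "region_of \<alpha> p"] psum_le[of \<alpha> "region_of \<alpha> p"] assms
  by (auto simp: reach_row_of)

lemma count_list_Flip_nu_of [simp]:
  "count_list (Flip (nu_of \<alpha>)) s = sum_list \<alpha>"
  using endpoint_nu_of[of "rev \<alpha>"] unfolding Flip_nu_of by (cases s) (auto simp: endpoint_def)

lemma bracket_vector_iff_parent_map:
  assumes P: "\<And>k. 1 \<le> k \<Longrightarrow> k \<le> sum_list \<alpha> \<Longrightarrow> P k \<le> sum_list \<alpha>"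
    and b: "\<And>i. i < sum_list \<alpha> \<Longrightarrow> b i = row_of \<alpha> (P (sum_list \<alpha> - i))"
  shows "bracket_vector (Flip (nu_of \<alpha>)) b \<longleftrightarrow> parent_map \<alpha> P"
proof -
  let ?n = "sum_list \<alpha>"
  let ?\<nu> = "Flip (nu_of \<alpha>)"
  have bk: "b (?n - k) = row_of \<alpha> (P k)" if "1 \<le> k" "k \<le> ?n" for k
    using b[of "?n - k"] that by simp
  have bi: "b i = row_of \<alpha> (P (?n - i))" "1 \<le> ?n - i" "?n - i \<le> ?n" "?n - (?n - i) = i" if "i < ?n" for i
    using b that by auto
  have reach: "i < reach ?\<nu> (row_of \<alpha> p) \<longleftrightarrow> region_of \<alpha> p < region_of \<alpha> (?n - i)"
    if "i < ?n" "p \<le> ?n" for i p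
    using less_reach_row_of_iff[of "?n - i" \<alpha> p] that by simp
  show ?thesis
  proof
    assume bv: "bracket_vector ?\<nu> b"
    show "parent_map \<alpha> P"
      unfolding parent_map_def
    proof (intro conjI allI impI)
      fix k assume k: "1 \<le> k" "k \<le> ?n"
      show "P k \<le> ?n" using P k by simp
      show "region_of \<alpha> (P k) < region_of \<alpha> k"
        using bracket_vectorD(2)[OF bv, of "?n - k"] bk k P reach[of "?n - k" "P k"] by simp
    next
      fix j k assume jk: "1 \<le> j" "j < k" "k \<le> ?n" "region_of \<alpha> (P k) < region_of \<alpha> j"
      then have "b (?n - j) \<le> b (?n - k)"
        using bracket_vectorD(3)[OF bv, of "?n - k" "?n - j"] bk[of k] P[of k] reach[of "?n - j" "P k"] by simp
      then show "row_of \<alpha> (P j) \<le> row_of \<alpha> (P k)" using bk jk by simp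
    qed
  next
    assume pm: "parent_map \<alpha> P"
    show "bracket_vector ?\<nu> b"
      unfolding bracket_vector_def
    proof (intro conjI allI impI)
      fix i assume i: "i < count_list ?\<nu> E"
      then have i: "i < ?n" by simp
      note Pi = parent_mapD[OF pm bi(2,3)[OF i]]
      show "b i \<le> count_list ?\<nu> N" using bi(1)[OF i] Pi(1) row_of_bij[of \<alpha>] by (auto simp: bij_betw_def)
      show "i < reach ?\<nu> (b i)" using bi(1)[OF i] Pi reach[OF i] by simp
    next
      fix i j assume ij: "i < j \<and> j < reach ?\<nu> (b i)"
      then have j: "j < ?n" using reach_le[of ?\<nu> "b i"] by simp
      then have i: "i < ?n" using ij by simp
      note Pi = parent_mapD[OF pm bi(2,3)[OF i]]
      have "region_of \<alpha> (P (?n - i)) < region_of \<alpha> (?n - j)"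
        using reach[OF j Pi(1)] ij bi(1)[OF i] by simp
      then show "b j \<le> b i"
        using parent_row[OF pm, of "?n - j" "?n - i"] bi[OF i] bi[OF j] ij diff_le_mono2[of i j ?n]
        by simp
    qed
  qed
qed

section \<open>The step word of \<open>Flip (Theta \<alpha> w)\<close>\<close>

definition positions :: "nat list \<Rightarrow> nat list" where
  "positions \<alpha> =
     concat (map (\<lambda>a. [psum \<alpha> (a - 1) + 1..<psum \<alpha> a + 1]) (rev [1..<length \<alpha> + 1]))"

lemma concat_upt_antimono:
  fixes g :: "nat \<Rightarrow> nat"
  assumes "\<And>a. g (Suc a) \<le> g a"
  shows "concat (map (\<lambda>a. [g a..<g (a - 1)]) (rev [1..<Suc r])) = [g r..<g 0]"
proof (induction r)
  case (Suc r)
  have "g r \<le> g 0" using lift_Suc_antimono_le[of g 0 r] assms by simp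
  then have "[g (Suc r)..<g r] @ [g r..<g 0] = [g (Suc r)..<g 0]"
    using upt_add_eq_append[of "g (Suc r)" "g r" "g 0 - g r"] assms[of r] by simp
  then show ?case using Suc by simp
qed simp

text \<open>\<open>Theta\<close> lists the regions from left to right and each region from right to
  left; reversed by \<open>Flip\<close>, this is the order by increasing row.\<close>

lemma map_row_of_positions: "map (row_of \<alpha>) (positions \<alpha>) = [0..<sum_list \<alpha>]"
proof -
  let ?n = "sum_list \<alpha>"
  have reg: "map (row_of \<alpha>) [psum \<alpha> (a - 1) + 1..<psum \<alpha> a + 1] = [?n - psum \<alpha> a..<?n - psum \<alpha> (a - 1)]" for a
  proof (rule nth_equalityI)
    have le: "psum \<alpha> (a - 1) \<le> psum \<alpha> a" "psum \<alpha> a \<le> ?n" by (simp_all add: psum_mono psum_le)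
    then show "length (map (row_of \<alpha>) [psum \<alpha> (a - 1) + 1..<psum \<alpha> a + 1]) =
        length [?n - psum \<alpha> a..<?n - psum \<alpha> (a - 1)]" unfolding length_map length_upt by linarith
    fix i assume "i < length (map (row_of \<alpha>) [psum \<alpha> (a - 1) + 1..<psum \<alpha> a + 1])"
    then have i: "i < psum \<alpha> a - psum \<alpha> (a - 1)" by (simp del: upt_Suc)
    then have "region_of \<alpha> (psum \<alpha> (a - 1) + 1 + i) = a" by (intro region_of_eqI) auto
    then have "row_of \<alpha> (psum \<alpha> (a - 1) + 1 + i) = ?n - psum \<alpha> a + i" by (simp add: row_of_def)
    then show "map (row_of \<alpha>) [psum \<alpha> (a - 1) + 1..<psum \<alpha> a + 1] ! i =
        [?n - psum \<alpha> a..<?n - psum \<alpha> (a - 1)] ! i" using i le by (simp del: upt_Suc)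
  qed
  have "map (row_of \<alpha>) (positions \<alpha>) =
      concat (map (\<lambda>a. [?n - psum \<alpha> a..<?n - psum \<alpha> (a - 1)]) (rev [1..<Suc (length \<alpha>)]))"
    unfolding positions_def map_concat map_map comp_def reg by simp
  also have "\<dots> = [?n - psum \<alpha> (length \<alpha>)..<?n - psum \<alpha> 0]"
    by (rule concat_upt_antimono) (simp add: diff_le_mono2 psum_mono)
  finally show ?thesis by (simp add: psum_length)
qed

lemma set_positions: "set (positions \<alpha>) \<subseteq> {1..sum_list \<alpha>}"
proof
  fix p assume "p \<in> set (positions \<alpha>)"
  then obtain a where "p \<in> set [psum \<alpha> (a - 1) + 1..<psum \<alpha> a + 1]"
    unfolding positions_def by (auto simp del: upt_Suc)
  then show "p \<in> {1..sum_list \<alpha>}" using psum_le[of \<alpha> a] by (simp del: upt_Suc)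
qed

lemma set_take_positions:
  assumes "y < sum_list \<alpha>"
  shows "set (take (Suc y) (positions \<alpha>)) = {p. p \<le> sum_list \<alpha> \<and> row_of \<alpha> p \<le> y}"
proof -
  let ?n = "sum_list \<alpha>" and ?L = "positions \<alpha>"
  have inj: "inj_on (row_of \<alpha>) {0..?n}" using row_of_bij by (simp add: bij_betw_def)
  have "row_of \<alpha> ` set (take (Suc y) ?L) = set (take (Suc y) (map (row_of \<alpha>) ?L))"
    by (simp add: take_map)
  also have "\<dots> = {0..y}" using assms unfolding map_row_of_positions by (auto simp: take_upt)
  also have "\<dots> = row_of \<alpha> ` {p. p \<le> ?n \<and> row_of \<alpha> p \<le> y}"
  proof
    show "{0..y} \<subseteq> row_of \<alpha> ` {p. p \<le> ?n \<and> row_of \<alpha> p \<le> y}"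
    proof
      fix z assume z: "z \<in> {0..y}"
      then have "z \<in> row_of \<alpha> ` {0..?n}" using row_of_bij[of \<alpha>] assms by (auto simp: bij_betw_def)
      then show "z \<in> row_of \<alpha> ` {p. p \<le> ?n \<and> row_of \<alpha> p \<le> y}" using z by auto
    qed
  qed auto
  finally have "row_of \<alpha> ` set (take (Suc y) ?L) = row_of \<alpha> ` {p. p \<le> ?n \<and> row_of \<alpha> p \<le> y}" .
  moreover have "set (take (Suc y) ?L) \<subseteq> {0..?n}"
    using set_positions[of \<alpha>] set_take_subset[of "Suc y" ?L] by force
  moreover have "{p. p \<le> ?n \<and> row_of \<alpha> p \<le> y} \<subseteq> {0..?n}" by auto
  ultimately show ?thesis using inj_on_image_eq_iff[OF inj] by simp
qed

lemma length_positions [simp]: "length (positions \<alpha>) = sum_list \<alpha>"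
  using map_row_of_positions[of \<alpha>] by (metis diff_zero length_map length_upt)

lemma distinct_positions: "distinct (positions \<alpha>)"
  using map_row_of_positions[of \<alpha>] distinct_map[of "row_of \<alpha>" "positions \<alpha>"] by simp

lemma Flip_append: "Flip (\<mu> @ \<mu>') = Flip \<mu>' @ Flip \<mu>"
  by (simp add: Flip_def)

lemma Flip_concat: "Flip (concat ps) = concat (map Flip (rev ps))"
  by (induction ps) (auto simp: Flip_append, simp add: Flip_def)

text \<open>Each block \<open>E N^k\<close> becomes \<open>E^k N\<close>, so the children of
  \<open>p\<close> turn into the east steps of one row, and the initial north steps into the top
  row, that of the root.\<close>

lemma Flip_Theta:
  assumes perm: "w permutes {1..sum_list \<alpha>}"
  defines "c \<equiv> \<lambda>p. card {k. 1 \<le> k \<and> k \<le> sum_list \<alpha> \<and> par \<alpha> w k = p}"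
  shows "Flip (Theta \<alpha> w) = concat (map (\<lambda>p. replicate (c p) E @ [N]) (positions \<alpha>)) @ replicate (c 0) E"
proof -
  let ?T = "tree_of (sum_list \<alpha>) w"
  have "Flip (Theta \<alpha> w) =
      concat (map (\<lambda>p. replicate (num_children ?T (w p)) E @ [N]) (positions \<alpha>)) @
      replicate (length (children ?T)) E"
  proof -
    have concat_map: "concat (map (\<lambda>a. concat (map g (R a))) xs) = concat (map g (concat (map R xs)))"
      for g :: "nat \<Rightarrow> path" and R :: "nat \<Rightarrow> nat list" and xs
      by (induction xs) auto
    have Flip_row: "Flip (E # replicate k N) = replicate k E @ [N]" "Flip (replicate k N) = replicate k E" for k
      by (simp_all add: Flip_def)
    show ?thesis
      unfolding Theta_def Let_def Flip_append Flip_concat positions_def concat_map[symmetric]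
      by (simp add: rev_map comp_def Flip_concat Flip_row del: upt_Suc)
  qed
  also have "map (\<lambda>p. replicate (num_children ?T (w p)) E @ [N]) (positions \<alpha>) =
      map (\<lambda>p. replicate (c p) E @ [N]) (positions \<alpha>)"
    using set_positions[of \<alpha>] num_children_tree_of(2)[OF perm] by (intro map_cong) (auto simp: c_def)
  also have "length (children ?T) = c 0"
    using num_children_tree_of(1)[OF perm] by (simp add: c_def)
  finally show ?thesis .
qed

lemma reach_rows:
  "reach (concat (map (\<lambda>p. replicate (c p) E @ [N]) L) @ \<mu>) y =
     (if y < length L then sum_list (map c (take (Suc y) L))
      else sum_list (map c L) + reach \<mu> (y - length L))"
proof (induction L arbitrary: y)
  case (Cons p L)
  show ?case
  proof (cases y)
    case 0
    then show ?thesis by (simp add: reach_replicate_E)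
  next
    case (Suc z)
    then show ?thesis using Cons[of z] by (simp add: reach_replicate_E)
  qed
qed simp

lemma endpoint_rows:
  "endpoint (concat (map (\<lambda>p. replicate (c p) E @ [N]) L) @ replicate k E) =
     (sum_list (map c L) + k, length L)"
  by (induction L) (auto simp: endpoint_def count_list_replicate)

lemma sum_card_fibres:
  assumes "finite K" "finite S"
  shows "(\<Sum>p\<in>S. card {k \<in> K. f k = p}) = card {k \<in> K. f k \<in> S}"
proof -
  have "(\<Sum>p\<in>S. card {k \<in> K. f k = p}) = card (\<Union>p\<in>S. {k \<in> K. f k = p})"
    using assms by (intro card_UN_disjoint[symmetric]) auto
  also have "(\<Union>p\<in>S. {k \<in> K. f k = p}) = {k \<in> K. f k \<in> S}" by auto
  finally show ?thesis .
qed

lemma bracket_of_Flip_Theta: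
  assumes av: "avoiding \<alpha> w"
  shows "bracket_of (Flip (nu_of \<alpha>)) (Flip (Theta \<alpha> w))
    (\<lambda>i. row_of \<alpha> (par \<alpha> w (sum_list \<alpha> - i)))"
proof -
  let ?n = "sum_list \<alpha>" and ?\<nu> = "Flip (nu_of \<alpha>)" and ?L = "positions \<alpha>"
  note perm = avoiding_permutes[OF av]
  let ?K = "{1..?n}"
  define c where "c p = card {k \<in> ?K. par \<alpha> w k = p}" for p
  have par_le: "par \<alpha> w k \<le> ?n" if "k \<in> ?K" for k
    using par(1)[OF perm, of k] that by simp
  have row_le: "row_of \<alpha> p \<le> ?n" if "p \<le> ?n" for p
    using row_of_bij[of \<alpha>] that by (auto simp: bij_betw_def)
  have \<mu>: "Flip (Theta \<alpha> w) = concat (map (\<lambda>p. replicate (c p) E @ [N]) ?L) @ replicate (c 0) E"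
    unfolding Flip_Theta[OF perm] c_def by simp
  have sums: "sum_list (map c L) = card {k \<in> ?K. par \<alpha> w k \<in> set L}" if "distinct L" for L
    unfolding c_def using that by (simp add: sum_list_distinct_conv_sum_set sum_card_fibres del: atLeastAtMost_iff)
  have set_L: "set ?L = {1..?n}"
    using set_positions[of \<alpha>] distinct_card[OF distinct_positions[of \<alpha>]] by (intro card_subset_eq) auto
  \<comment> \<open>With the root included, the fibres of the parent map exhaust all
    positions.\<close>
  have "sum_list (map c (0 # ?L)) = card {k \<in> ?K. par \<alpha> w k \<in> set (0 # ?L)}"
    using distinct_positions set_L by (intro sums) auto
  also have "{k \<in> ?K. par \<alpha> w k \<in> set (0 # ?L)} = ?K"
    using par_le unfolding set_L by (auto simp: set_L)
  finally have total: "c 0 + sum_list (map c ?L) = ?n" by simp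
  have end_eq: "endpoint (Flip (Theta \<alpha> w)) = (?n, ?n)"
    unfolding \<mu> endpoint_rows using total by simp
  have "reach (Flip (Theta \<alpha> w)) y = card {i. i < ?n \<and> row_of \<alpha> (par \<alpha> w (?n - i)) \<le> y}" for y
  proof -
    have "bij_betw (\<lambda>i. ?n - i) {i. i < ?n \<and> row_of \<alpha> (par \<alpha> w (?n - i)) \<le> y}
        {k \<in> ?K. row_of \<alpha> (par \<alpha> w k) \<le> y}"
      by (rule bij_betw_byWitness[where f' = "\<lambda>k. ?n - k"]) auto
    then have card: "card {i. i < ?n \<and> row_of \<alpha> (par \<alpha> w (?n - i)) \<le> y} =
        card {k \<in> ?K. row_of \<alpha> (par \<alpha> w k) \<le> y}" by (rule bij_betw_same_card)
    show ?thesis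
    proof (cases "y < ?n")
      case True
      have "reach (Flip (Theta \<alpha> w)) y = sum_list (map c (take (Suc y) ?L))"
        unfolding \<mu> reach_rows using True by simp
      also have "\<dots> = card {k \<in> ?K. par \<alpha> w k \<in> set (take (Suc y) ?L)}"
        using distinct_positions by (intro sums) simp
      also have "{k \<in> ?K. par \<alpha> w k \<in> set (take (Suc y) ?L)} = {k \<in> ?K. row_of \<alpha> (par \<alpha> w k) \<le> y}"
        unfolding set_take_positions[OF True] using par_le by auto
      finally show ?thesis using card by simp
    next
      case False
      then have "reach (Flip (Theta \<alpha> w)) y = ?n"
        using end_eq by (simp add: reach_total endpoint_def)
      moreover have "row_of \<alpha> (par \<alpha> w k) \<le> y" if "k \<in> ?K" for k
        using row_le[OF par_le[OF that]] False by simp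
      then have "{k \<in> ?K. row_of \<alpha> (par \<alpha> w k) \<le> y} = ?K" by auto
      ultimately show ?thesis using card by simp
    qed
  qed
  moreover have "bracket_vector ?\<nu> (\<lambda>i. row_of \<alpha> (par \<alpha> w (?n - i)))"
    using bracket_vector_iff_parent_map[of \<alpha> "par \<alpha> w"] par_le parent_map_par[OF av] by simp
  moreover have "endpoint ?\<nu> = (?n, ?n)" by (simp add: endpoint_def)
  ultimately show ?thesis using end_eq by (simp add: bracket_of_def)
qed

section \<open>The anti-isomorphism\<close>

lemma alpha_perms_231_iff: "w \<in> alpha_perms_231 \<alpha> \<longleftrightarrow> avoiding \<alpha> w"
proof -
  let ?n = "sum_list \<alpha>"
  have incr: "(\<forall>i. i \<in> {1..?n} \<and> i + 1 \<in> {1..?n} \<and> region_index \<alpha> i = region_index \<alpha> (i + 1) \<longrightarrow> w i < w (i + 1))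
     \<longleftrightarrow> (\<forall>i j. 1 \<le> i \<longrightarrow> i < j \<longrightarrow> j \<le> ?n \<longrightarrow> region_of \<alpha> i = region_of \<alpha> j \<longrightarrow> w i < w j)"
    (is "?A \<longleftrightarrow> ?B")
  proof
    assume A: ?A
    have "w i < w j" if "1 \<le> i" "i < j" "j \<le> ?n" "region_of \<alpha> i = region_of \<alpha> j" for i j
      using that
    proof (induction j)
      case (Suc j)
      show ?case
      proof (cases "i = j")
        case True
        then show ?thesis using A Suc.prems by (auto simp: region_index_eq)
      next
        case False
        then have "i < j" using Suc.prems by simp
        then have r: "region_of \<alpha> j = region_of \<alpha> (Suc j)"
          using Suc.prems reg_mono[of i j \<alpha>] reg_mono[of j "Suc j" \<alpha>] by simp
        then have "w j < w (j + 1)" using A Suc.prems \<open>i < j\<close> by (auto simp: region_index_eq)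
        moreover have "w i < w j" using Suc.IH Suc.prems \<open>i < j\<close> r by simp
        ultimately show ?thesis by simp
      qed
    qed simp
    then show ?B by blast
  next
    assume ?B
    then show ?A by (auto simp: region_index_eq)
  qed
  have pat: "has_alpha_231 \<alpha> w \<longleftrightarrow> (\<exists>i j k. 1 \<le> i \<and> i < j \<and> j < k \<and> k \<le> ?n \<and>
      region_of \<alpha> i \<noteq> region_of \<alpha> j \<and> region_of \<alpha> j \<noteq> region_of \<alpha> k \<and>
      region_of \<alpha> i \<noteq> region_of \<alpha> k \<and> w i < w j \<and> w i = w k + 1)"
    unfolding has_alpha_231_def by (intro ex_cong1) (auto simp: region_index_eq)
  show ?thesis
    unfolding alpha_perms_231_def alpha_perms_def avoiding_def mem_Collect_eq incr pat by blast
qed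

text \<open>\<open>w k\<close> is the number of positions \<open>j\<close> with
  \<open>w j \<le> w k\<close>, and these can be read off the inversions.\<close>

lemma permutes_eqI_Inv:
  assumes u: "u permutes {1..n}" and v: "v permutes {1..n}" and eq: "Inv n u = Inv n v"
  shows "u = v"
proof
  fix k
  show "u k = v k"
  proof (cases "k \<in> {1..n}")
    case True
    have card: "card {j \<in> {1..n}. w j \<le> w k} = w k" if w: "w permutes {1..n}" for w
    proof -
      have "w ` {j \<in> {1..n}. w j \<le> w k} = {1..w k}"
      proof
        show "{1..w k} \<subseteq> w ` {j \<in> {1..n}. w j \<le> w k}"
        proof
          fix x assume x: "x \<in> {1..w k}"
          have "w k \<le> n" using permutes_in_image[OF w, of k] True by simp
          then have "x \<in> {1..n}" using x by simp
          then have "x \<in> w ` {1..n}" using permutes_image[OF w] by simp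
          then show "x \<in> w ` {j \<in> {1..n}. w j \<le> w k}" using x by auto
        qed
        show "w ` {j \<in> {1..n}. w j \<le> w k} \<subseteq> {1..w k}"
          using permutes_in_image[OF w] by fastforce
      qed
      moreover have "inj_on w {j \<in> {1..n}. w j \<le> w k}" using permutes_inj_on[OF w] .
      ultimately show ?thesis using card_image by fastforce
    qed
    have le: "w j \<le> w k \<longleftrightarrow> j = k \<or> (j < k \<and> (j, k) \<notin> Inv n w) \<or> (k < j \<and> (k, j) \<in> Inv n w)"
      if "j \<in> {1..n}" "w permutes {1..n}" for j w
    proof (cases "k < j")
      case True
      then have "w j \<noteq> w k" using permutes_inj[OF that(2)] by (auto dest: injD)
      then show ?thesis using True that(1) \<open>k \<in> {1..n}\<close> by (auto simp: Inv_def)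
    next
      case False
      then show ?thesis using that(1) \<open>k \<in> {1..n}\<close> by (cases "j = k") (auto simp: Inv_def)
    qed
    have "{j \<in> {1..n}. u j \<le> u k} = {j \<in> {1..n}. v j \<le> v k}"
      using le u v eq by blast
    then show ?thesis using card[OF u] card[OF v] by simp
  next
    case False
    then show ?thesis using u v by (simp add: permutes_not_in)
  qed
qed

theorem corollary6p11:
  fixes n :: nat and \<alpha> :: "nat list"
  assumes "n > 0" and "is_composition \<alpha> n"
  shows "anti_isomorphism
           (alpha_perms_231 \<alpha>) (weak_le n)
           (paths_above (Flip (nu_of \<alpha>))) (nu_tamari_le (Flip (nu_of \<alpha>)))
           (Flip \<circ> Theta \<alpha>)"
proof -
  let ?\<nu> = "Flip (nu_of \<alpha>)" and ?f = "Flip \<circ> Theta \<alpha>" and ?S = "alpha_perms_231 \<alpha>"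
  have n: "n = sum_list \<alpha>" using assms(2) by (simp add: is_composition_def)
  define bv where "bv w i = row_of \<alpha> (par \<alpha> w (n - i))" for w i
  have bracket: "bracket_of ?\<nu> (?f w) (bv w)" if "w \<in> ?S" for w
    using bracket_of_Flip_Theta[of \<alpha> w] that unfolding alpha_perms_231_iff bv_def n by simp
  have order: "weak_le n u v \<longleftrightarrow> nu_tamari_le ?\<nu> (?f v) (?f u)" if uv: "u \<in> ?S" "v \<in> ?S" for u v
  proof -
    have "weak_le n u v \<longleftrightarrow>
        (\<forall>k. 1 \<le> k \<longrightarrow> k \<le> n \<longrightarrow> row_of \<alpha> (par \<alpha> v k) \<le> row_of \<alpha> (par \<alpha> u k))"
      using Inv_subset_iff[of \<alpha> u v] uv unfolding alpha_perms_231_iff weak_le_def n by simp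
    also have "\<dots> \<longleftrightarrow> (\<forall>i < n. bv v i \<le> bv u i)"
    proof
      assume *: "\<forall>i < n. bv v i \<le> bv u i"
      show "\<forall>k. 1 \<le> k \<longrightarrow> k \<le> n \<longrightarrow> row_of \<alpha> (par \<alpha> v k) \<le> row_of \<alpha> (par \<alpha> u k)"
      proof (intro allI impI)
        fix k assume "1 \<le> k" "k \<le> n"
        then show "row_of \<alpha> (par \<alpha> v k) \<le> row_of \<alpha> (par \<alpha> u k)"
          using *[rule_format, of "n - k"] by (simp add: bv_def)
      qed
    qed (simp add: bv_def)
    also have "\<dots> \<longleftrightarrow> nu_tamari_le ?\<nu> (?f v) (?f u)"
      using nu_tamari_le_iff[OF bracket[OF uv(2)] bracket[OF uv(1)]] n by simp
    finally show ?thesis .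
  qed
  have bij: "bij_betw ?f ?S (paths_above ?\<nu>)"
    unfolding bij_betw_def
  proof
    show "inj_on ?f ?S"
    proof (rule inj_onI)
      fix u v assume uv: "u \<in> ?S" "v \<in> ?S" "?f u = ?f v"
      \<comment> \<open>Equal images are related both ways by reflexivity, so the inversion sets
        coincide.\<close>
      then have "weak_le n u v" "weak_le n v u"
        using order by (simp_all add: nu_tamari_le_def)
      then show "u = v"
        using uv permutes_eqI_Inv[of u n v] avoiding_permutes unfolding alpha_perms_231_iff weak_le_def n by blast
    qed
    show "?f ` ?S = paths_above ?\<nu>"
    proof
      show "?f ` ?S \<subseteq> paths_above ?\<nu>" using bracket bracket_of_paths_above by blast
      show "paths_above ?\<nu> \<subseteq> ?f ` ?S"
      proof
        fix \<mu> assume "\<mu> \<in> paths_above ?\<nu>"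
        then obtain b where b: "bracket_of ?\<nu> \<mu> b" using ex_bracket_of by blast
        then have bb: "bracket_vector ?\<nu> b" by (simp add: bracket_of_def)
        \<comment> \<open>The parent of \<open>k\<close> must be the position whose row is the entry
          of item \<open>n - k\<close>.\<close>
        define P where "P k = inv_into {0..n} (row_of \<alpha>) (b (n - k))" for k
        have P: "P k \<le> n" "row_of \<alpha> (P k) = b (n - k)" if "1 \<le> k" "k \<le> n" for k
        proof -
          have "b (n - k) \<in> row_of \<alpha> ` {0..n}"
            using bracket_vectorD(1)[OF bb, of "n - k"] that row_of_bij[of \<alpha>] n by (simp add: bij_betw_def)
          then show "P k \<le> n" "row_of \<alpha> (P k) = b (n - k)"
            unfolding P_def using inv_into_into[of _ "row_of \<alpha>" "{0..n}"] f_inv_into_f[of _ "row_of \<alpha>" "{0..n}"]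
            by auto
        qed
        have "parent_map \<alpha> P"
          using bracket_vector_iff_parent_map[of \<alpha> P b] P bb n by simp
        then obtain w where w: "avoiding \<alpha> w" "\<forall>k. 1 \<le> k \<longrightarrow> k \<le> n \<longrightarrow> par \<alpha> w k = P k"
          using ex_avoiding_par n by blast
        then have wS: "w \<in> ?S" by (simp add: alpha_perms_231_iff)
        have "bv w i = b i" if "i < n" for i
          using w(2) P(2)[of "n - i"] that by (simp add: bv_def)
        then have "?f w = \<mu>" using bracket_of_inj[OF bracket[OF wS] b] n by simp
        then show "\<mu> \<in> ?f ` ?S" using wS by blast
      qed
    qed
  qed
  have "monotone_on (paths_above ?\<nu>) (nu_tamari_le ?\<nu>) (\<lambda>x y. weak_le n y x) (inv_into ?S ?f)"
  proof (rule monotone_onI)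
    fix \<mu> \<mu>' assume m: "\<mu> \<in> paths_above ?\<nu>" "\<mu>' \<in> paths_above ?\<nu>" "nu_tamari_le ?\<nu> \<mu> \<mu>'"
    have "inv_into ?S ?f \<mu> \<in> ?S" "inv_into ?S ?f \<mu>' \<in> ?S"
      "?f (inv_into ?S ?f \<mu>) = \<mu>" "?f (inv_into ?S ?f \<mu>') = \<mu>'"
      using m bij bij_betw_inv_into_right[OF bij] inv_into_into[of _ ?f ?S] by (auto simp: bij_betw_def)
    then show "weak_le n (inv_into ?S ?f \<mu>') (inv_into ?S ?f \<mu>)" using order m(3) by metis
  qed
  moreover have "monotone_on ?S (weak_le n) (\<lambda>x y. nu_tamari_le ?\<nu> y x) ?f"
    using order by (intro monotone_onI) simp
  ultimately show ?thesis using bij by (simp add: anti_isomorphism_def)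
qed

end
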